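(* Let $X$ be a connected graph with a chosen basepoint $x_0$, and assume $Z_1(X,\mathbb{R})$ is finite-dimensional. Let $A$ be the set of atoms of $X$ (the vertices of the maximal abelian cover $\overline{X}$) and let $i\colon A\to Z_1(X,\mathbb{R})$ be the map $i(\llbracket\alpha\rrbracket)=\pi(c_\alpha)$. Then $i$ extends uniquely to a map $$j\colon |\overline{X}|\to Z_1(X,\mathbb{R})$$ that is affine on bonds. If $X$ is also bridgeless, then $j$ is one-to-one.
   Context: Graphs. A graph $X=(E,V,s,t,\mathrm{inv})$ consists of a set $V$ of vertices, a set $E$ of edges, source and target maps $s,t\colon E\to V$, and a map $\mathrm{inv}\colon E\to E$, $e\mapsto e^{-1}$, with $s(e^{-1})=t(e)$, $t(e^{-1})=s(e)$, $(e^{-1})^{-1}=e$ and $e^{-1}\neq e$ for all $e$. Write $e\colon v\to w$ if $s(e)=v$, $t(e)=w$. (Multiple edges and self-loops are allowed.) An edge $e$ of a graph is a bridge if removing it (together with $e^{-1}$) disconnects the graph; a graph is bridgeless if it has no bridges. Paths. A path $\gamma\colon x\to y$ is a word of edges $\gamma=e_1\cdots e_\ell$ with $e_k\colon v_{k-1}\to v_k$, $v_0=x$, $v_\ell=y$; the empty word is allowed iff $x=y$ (trivial path). Paths are composed by concatenation. A loop based at $x$ is a path $x\to x$. Two paths are homologous if one can be obtained from the other by finitely many moves of the following types: introducing or deleting a subword $e e^{-1}$; replacing a subword $\lambda\mu$ by $\mu\lambda$, where $\lambda,\mu$ are loops based at the same vertex. $\llbracket\gamma\rrbracket$ denotes the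 homology class of $\gamma$; homologous paths have the same start and the same end. Maximal abelian cover. The vertices of $\overline{X}$, called atoms, are the homology classes $\llbracket\alpha\rrbracket\colon x_0\to x$ of paths starting at $x_0$ (with $x$ arbitrary); $A$ is the set of atoms. The edges of $\overline{X}$ are the pairs $(\llbracket\alpha\rrbracket\colon x_0\to x,\ e\colon x\to y)$; such an edge has source $\llbracket\alpha\rrbracket$, target $\llbracket\alpha e\rrbracket$ and inverse $(\llbracket\alpha e\rrbracket,e^{-1})$. Geometric realization. For a graph $Y$, $|Y|$ is the space obtained by taking one point for each vertex, gluing on a copy of $[0,1]$ for each edge $e\colon v\to w$ with $0$ glued to $v$ and $1$ glued to $w$, and identifying the interval of $e$ with that of $e^{-1}$ via $t\mapsto 1-t$. The closed intervals in $|\overline{X}|$ given by edges of $\overline{X}$ are called bonds; each edge gives a parametrization $\phi\colon[0,1]\to|\overline{X}|$ of its bond. The atoms are regarded as points of $|\overline{X}|$. A map $f\colon|\overline{X}|\to W$ to a finite-dimensional real vector space is affine on bonds if for every bond, $f(\phi(t))=a+bt$ for some $a,b\in W$ and all $t\in[0,1]$. Chains. $C_0(X,\mathbb{Z})$ is the free abelian group on $V$; $C_1(X,\mathbb{Z})$ is the free abelian group on $E$ modulo the relations $e^{-1}=-e$; $\partial\colon C_1(X,\mathbb{Z})\to C_0(X,\mathbb{Z})$ is given by $\partial e=t(e)-s(e)$. $C_k(X,\mathbb{R})=C_k(X,\mathbb{Z})\otimes\mathbb{R}$, and $Z_1(X,\mathbb{R})=\ker(\partial\colon C_1(X,\mathbb{R})\to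 C_0(X,\mathbb{R}))$ is the space of 1-cycles. $C_1(X,\mathbb{R})$ has the inner product for which edges form an orthonormal basis (one edge chosen from each pair $\{e,e^{-1}\}$, with $e^{-1}=-e$), and $\pi\colon C_1(X,\mathbb{R})\to Z_1(X,\mathbb{R})$ is the orthogonal projection. For a path $\gamma=e_1\cdots e_n$, $c_\gamma=e_1+\cdots+e_n$. Homologous paths give the same 1-chain, so $i$ is well-defined. *)

theory Defs
  imports "HOL-Analysis.Analysis" "HOL-Analysis.Finite_Function_Topology" "Graph_Theory.Graph_Theory"
begin

text \<open>
  A graph \<open>(E, V, s, t, inv)\<close> is a \<^const>\<open>bidirected_digraph\<close> \<open>X arev\<close>: the fields of \<open>X\<close> are
  \<open>V\<close> (\<open>verts\<close>), \<open>E\<close> (\<open>arcs\<close>), \<open>s\<close> (\<open>tail\<close>) and \<open>t\<close> (\<open>head\<close>), and \<open>arev\<close> is the fixed-point free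
  involution \<open>inv\<close> on \<open>E\<close>, totalized by the identity outside \<open>E\<close>. Infinite graphs, multiple edges
  and self-loops are allowed. A path \<open>u \<rightarrow> v\<close> is a word \<open>p\<close> with \<open>pre_digraph.awalk X u p v\<close>.
\<close>


section \<open>Bridges\<close>

text \<open>Only used for connected graphs, where ``disconnects'' means ``leaves a disconnected graph''.\<close>

definition is_bridge :: "('v, 'e) pre_digraph \<Rightarrow> ('e \<Rightarrow> 'e) \<Rightarrow> 'e \<Rightarrow> bool" where
  "is_bridge X arev e \<longleftrightarrow> e \<in> arcs X \<and>
     \<not> Digraph_Component.connected (pre_digraph.del_arc (pre_digraph.del_arc X e) (arev e))"

definition bridgeless :: "('v, 'e) pre_digraph \<Rightarrow> ('e \<Rightarrow> 'e) \<Rightarrow> bool" where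
  "bridgeless X arev \<longleftrightarrow> (\<forall>e. \<not> is_bridge X arev e)"


section \<open>Homology of paths\<close>

text \<open>
  Moves between words that are paths starting at \<open>u\<close>. Introducing a subword \<open>e e\<^sup>-\<^sup>1\<close> is the inverse
  of \<open>backtrack\<close>, which is accounted for by the equivalence closure below.
\<close>

inductive homology_move ::
  "('v, 'e) pre_digraph \<Rightarrow> ('e \<Rightarrow> 'e) \<Rightarrow> 'v \<Rightarrow> 'e list \<Rightarrow> 'e list \<Rightarrow> bool"
  for X :: "('v, 'e) pre_digraph" and arev :: "'e \<Rightarrow> 'e" and u :: 'v
where
  backtrack: "pre_digraph.awalk X u (p @ [e, arev e] @ q) w \<Longrightarrow>
    homology_move X arev u (p @ [e, arev e] @ q) (p @ q)"
| swap: "pre_digraph.awalk X u p v \<Longrightarrow> pre_digraph.awalk X v l v \<Longrightarrow>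
    pre_digraph.awalk X v m v \<Longrightarrow> pre_digraph.awalk X v q w \<Longrightarrow>
    homology_move X arev u (p @ l @ m @ q) (p @ m @ l @ q)"

definition homologous ::
  "('v, 'e) pre_digraph \<Rightarrow> ('e \<Rightarrow> 'e) \<Rightarrow> 'v \<Rightarrow> 'e list \<Rightarrow> 'e list \<Rightarrow> bool" where
  "homologous X arev u = equivclp (homology_move X arev u)"

definition homology_class ::
  "('v, 'e) pre_digraph \<Rightarrow> ('e \<Rightarrow> 'e) \<Rightarrow> 'v \<Rightarrow> 'e list \<Rightarrow> 'e list set" where
  "homology_class X arev u p = {q. homologous X arev u p q}"


section \<open>The maximal abelian cover\<close>

definition atoms :: "('v, 'e) pre_digraph \<Rightarrow> ('e \<Rightarrow> 'e) \<Rightarrow> 'v \<Rightarrow> 'e list set set" where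
  "atoms X arev x0 = {homology_class X arev x0 p | p x. pre_digraph.awalk X x0 p x}"

definition cover_arcs :: "('v, 'e) pre_digraph \<Rightarrow> ('e \<Rightarrow> 'e) \<Rightarrow> 'v \<Rightarrow> ('e list set \<times> 'e) set" where
  "cover_arcs X arev x0 =
     {(homology_class X arev x0 p, e) | p e. e \<in> arcs X \<and> pre_digraph.awalk X x0 p (tail X e)}"

text \<open>The class of \<open>p e\<close> for a representative \<open>p\<close> of \<open>a\<close>; independence of the choice is
  \<open>cover_head_homology_class\<close> below.\<close>

definition cover_head ::
  "('v, 'e) pre_digraph \<Rightarrow> ('e \<Rightarrow> 'e) \<Rightarrow> 'v \<Rightarrow> 'e list set \<times> 'e \<Rightarrow> 'e list set" where
  "cover_head X arev x0 = (\<lambda>(a, e). homology_class X arev x0 ((SOME p. p \<in> a) @ [e]))"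

definition max_abelian_cover ::
  "('v, 'e) pre_digraph \<Rightarrow> ('e \<Rightarrow> 'e) \<Rightarrow> 'v \<Rightarrow> ('e list set, 'e list set \<times> 'e) pre_digraph" where
  "max_abelian_cover X arev x0 =
     \<lparr>verts = atoms X arev x0, arcs = cover_arcs X arev x0,
      tail = fst, head = cover_head X arev x0\<rparr>"

definition cover_rev ::
  "('v, 'e) pre_digraph \<Rightarrow> ('e \<Rightarrow> 'e) \<Rightarrow> 'v \<Rightarrow> 'e list set \<times> 'e \<Rightarrow> 'e list set \<times> 'e" where
  "cover_rev X arev x0 b =
     (if b \<in> cover_arcs X arev x0 then (cover_head X arev x0 b, arev (snd b)) else b)"


section \<open>Geometric realization\<close>

text \<open>
  The disjoint union of the vertices and of one copy of \<open>[0, 1]\<close> for each edge. Points of the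
  realization are the classes of the equivalence relation generated by \<open>gluing\<close>.
\<close>

definition realization_cells :: "('v, 'e) pre_digraph \<Rightarrow> ('v + 'e \<times> real) set" where
  "realization_cells Y = Inl ` verts Y \<union> Inr ` (arcs Y \<times> {0..1})"

inductive gluing ::
  "('v, 'e) pre_digraph \<Rightarrow> ('e \<Rightarrow> 'e) \<Rightarrow> 'v + 'e \<times> real \<Rightarrow> 'v + 'e \<times> real \<Rightarrow> bool"
  for Y :: "('v, 'e) pre_digraph" and rv :: "'e \<Rightarrow> 'e"
where
  "e \<in> arcs Y \<Longrightarrow> gluing Y rv (Inr (e, 0)) (Inl (tail Y e))"
| "e \<in> arcs Y \<Longrightarrow> gluing Y rv (Inr (e, 1)) (Inl (head Y e))"
| "e \<in> arcs Y \<Longrightarrow> t \<in> {0..1} \<Longrightarrow> gluing Y rv (Inr (e, t)) (Inr (rv e, 1 - t))"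

definition glued ::
  "('v, 'e) pre_digraph \<Rightarrow> ('e \<Rightarrow> 'e) \<Rightarrow> 'v + 'e \<times> real \<Rightarrow> ('v + 'e \<times> real) set" where
  "glued Y rv z = {z'. equivclp (gluing Y rv) z z'}"

definition realization ::
  "('v, 'e) pre_digraph \<Rightarrow> ('e \<Rightarrow> 'e) \<Rightarrow> ('v + 'e \<times> real) set set" where
  "realization Y rv = glued Y rv ` realization_cells Y"

definition vertex_point ::
  "('v, 'e) pre_digraph \<Rightarrow> ('e \<Rightarrow> 'e) \<Rightarrow> 'v \<Rightarrow> ('v + 'e \<times> real) set" where
  "vertex_point Y rv v = glued Y rv (Inl v)"

definition bond_param ::
  "('v, 'e) pre_digraph \<Rightarrow> ('e \<Rightarrow> 'e) \<Rightarrow> 'e \<Rightarrow> real \<Rightarrow> ('v + 'e \<times> real) set" where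
  "bond_param Y rv e t = glued Y rv (Inr (e, t))"

text \<open>
  The quotient topology. Vertices are discrete in the disjoint union, so only the preimages in the
  intervals matter.
\<close>

definition realization_topology ::
  "('v, 'e) pre_digraph \<Rightarrow> ('e \<Rightarrow> 'e) \<Rightarrow> ('v + 'e \<times> real) set topology" where
  "realization_topology Y rv = topology (\<lambda>U. U \<subseteq> realization Y rv \<and>
     (\<forall>e\<in>arcs Y. openin (top_of_set {0..1}) {t \<in> {0..1}. bond_param Y rv e t \<in> U}))"

definition affine_on_bonds ::
  "('v, 'e) pre_digraph \<Rightarrow> ('e \<Rightarrow> 'e) \<Rightarrow> 'w::real_vector set \<Rightarrow> (('v + 'e \<times> real) set \<Rightarrow> 'w) \<Rightarrow> bool"
where
  "affine_on_bonds Y rv W f \<longleftrightarrow>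
     (\<forall>e\<in>arcs Y. \<exists>a\<in>W. \<exists>b\<in>W. \<forall>t\<in>{0..1}. f (bond_param Y rv e t) = a + t *\<^sub>R b)"


section \<open>Chains\<close>

text \<open>
  \<open>C\<^sub>1(X, \<real>)\<close>, the real vector space generated by the edges modulo \<open>e\<^sup>-\<^sup>1 = -e\<close>, is modelled by
  the antisymmetric finitely supported functions on the edges; the class of an edge \<open>e\<close> is the
  function with value \<open>1\<close> at \<open>e\<close> and \<open>-1\<close> at \<open>e\<^sup>-\<^sup>1\<close>. That this is the quotient is shown in
  \<open>chains_eq_image\<close> and \<open>edge_relations_kernel\<close> below.
\<close>

definition chains :: "('v, 'e) pre_digraph \<Rightarrow> ('e \<Rightarrow> 'e) \<Rightarrow> ('e \<Rightarrow>\<^sub>0 real) set" where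
  "chains X arev = {c. Poly_Mapping.keys c \<subseteq> arcs X \<and>
     (\<forall>e\<in>arcs X. Poly_Mapping.lookup c (arev e) = - Poly_Mapping.lookup c e)}"

definition edge_chain :: "('e \<Rightarrow> 'e) \<Rightarrow> 'e \<Rightarrow> 'e \<Rightarrow>\<^sub>0 real" where
  "edge_chain arev e = Poly_Mapping.single e 1 - Poly_Mapping.single (arev e) 1"

definition path_chain :: "('e \<Rightarrow> 'e) \<Rightarrow> 'e list \<Rightarrow> 'e \<Rightarrow>\<^sub>0 real" where
  "path_chain arev p = sum_list (map (edge_chain arev) p)"

text \<open>
  A chain is half the sum of \<open>c(e) e\<close> over all edges, since each pair \<open>{e, e\<^sup>-\<^sup>1}\<close> is counted twice.
  This gives the factors \<open>1/2\<close> here; see \<open>boundary_edge_chain\<close> and \<open>chain_inner_edge_chain\<close>.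
\<close>

definition boundary :: "('v, 'e) pre_digraph \<Rightarrow> ('e \<Rightarrow>\<^sub>0 real) \<Rightarrow> ('v \<Rightarrow>\<^sub>0 real)" where
  "boundary X c = (\<Sum>e\<in>Poly_Mapping.keys c. (Poly_Mapping.lookup c e / 2) *\<^sub>R
     (Poly_Mapping.single (head X e) 1 - Poly_Mapping.single (tail X e) 1))"

definition chain_inner :: "('e \<Rightarrow>\<^sub>0 real) \<Rightarrow> ('e \<Rightarrow>\<^sub>0 real) \<Rightarrow> real" where
  "chain_inner c d =
     (\<Sum>e\<in>Poly_Mapping.keys c. Poly_Mapping.lookup c e * Poly_Mapping.lookup d e) / 2"

definition cycles :: "('v, 'e) pre_digraph \<Rightarrow> ('e \<Rightarrow> 'e) \<Rightarrow> ('e \<Rightarrow>\<^sub>0 real) set" where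
  "cycles X arev = {c \<in> chains X arev. boundary X c = 0}"

definition finite_dimensional :: "'w::real_vector set \<Rightarrow> bool" where
  "finite_dimensional W \<longleftrightarrow> (\<exists>B. finite B \<and> span B = W)"

text \<open>The orthogonal projection onto the cycles; a unique such \<open>z\<close> exists for every chain \<open>c\<close> when
  the cycle space is finite-dimensional.\<close>

definition cycle_proj ::
  "('v, 'e) pre_digraph \<Rightarrow> ('e \<Rightarrow> 'e) \<Rightarrow> ('e \<Rightarrow>\<^sub>0 real) \<Rightarrow> 'e \<Rightarrow>\<^sub>0 real" where
  "cycle_proj X arev c =
     (THE z. z \<in> cycles X arev \<and> (\<forall>w\<in>cycles X arev. chain_inner (c - z) w = 0))"

text \<open>The map \<open>i\<close>; independence of the representative is \<open>atom_map_homology_class\<close> below.\<close>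

definition atom_map ::
  "('v, 'e) pre_digraph \<Rightarrow> ('e \<Rightarrow> 'e) \<Rightarrow> 'e list set \<Rightarrow> 'e \<Rightarrow>\<^sub>0 real" where
  "atom_map X arev a = cycle_proj X arev (path_chain arev (SOME p. p \<in> a))"

definition cover_space ::
  "('v, 'e) pre_digraph \<Rightarrow> ('e \<Rightarrow> 'e) \<Rightarrow> 'v \<Rightarrow>
   ('e list set + ('e list set \<times> 'e) \<times> real) set topology" where
  "cover_space X arev x0 =
     realization_topology (max_abelian_cover X arev x0) (cover_rev X arev x0)"

text \<open>
  Maps from the realization of the cover to the cycle space are taken to be extensional, so that
  equality of such maps is equality of functions on the realization.
\<close>

definition affine_extension ::
  "('v, 'e) pre_digraph \<Rightarrow> ('e \<Rightarrow> 'e) \<Rightarrow> 'v \<Rightarrow>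
   (('e list set + ('e list set \<times> 'e) \<times> real) set \<Rightarrow> ('e \<Rightarrow>\<^sub>0 real)) \<Rightarrow> bool" where
  "affine_extension X arev x0 j \<longleftrightarrow>
     j \<in> topspace (cover_space X arev x0) \<rightarrow>\<^sub>E cycles X arev \<and>
     (\<forall>a\<in>atoms X arev x0.
        j (vertex_point (max_abelian_cover X arev x0) (cover_rev X arev x0) a) = atom_map X arev a) \<and>
     affine_on_bonds (max_abelian_cover X arev x0) (cover_rev X arev x0) (cycles X arev) j"


section \<open>Consistency of the definitions\<close>

lemma openin_realization_topology:
  "openin (realization_topology Y rv) U \<longleftrightarrow> U \<subseteq> realization Y rv \<and>
     (\<forall>e\<in>arcs Y. openin (top_of_set {0..1}) {t \<in> {0..1}. bond_param Y rv e t \<in> U})"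
proof -
  let ?P = "\<lambda>U. U \<subseteq> realization Y rv \<and>
     (\<forall>e\<in>arcs Y. openin (top_of_set {0..1}) {t \<in> {0..1}. bond_param Y rv e t \<in> U})"
  have "istopology ?P"
    unfolding istopology_def
  proof (intro conjI allI impI)
    fix S T assume S: "?P S" and T: "?P T"
    show "S \<inter> T \<subseteq> realization Y rv" using S by auto
    show "\<forall>e\<in>arcs Y. openin (top_of_set {0..1}) {t \<in> {0..1}. bond_param Y rv e t \<in> S \<inter> T}"
    proof
      fix e assume "e \<in> arcs Y"
      with S T have "openin (top_of_set {0..1})
        ({t \<in> {0..1}. bond_param Y rv e t \<in> S} \<inter> {t \<in> {0..1}. bond_param Y rv e t \<in> T})"
        by (intro openin_Int) auto
      also have "{t \<in> {0..1}. bond_param Y rv e t \<in> S} \<inter> {t \<in> {0..1}. bond_param Y rv e t \<in> T}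
        = {t \<in> {0..1}. bond_param Y rv e t \<in> S \<inter> T}" by auto
      finally show "openin (top_of_set {0..1}) {t \<in> {0..1}. bond_param Y rv e t \<in> S \<inter> T}" .
    qed
  next
    fix K assume K: "\<forall>S\<in>K. ?P S"
    show "\<Union>K \<subseteq> realization Y rv" using K by blast
    show "\<forall>e\<in>arcs Y. openin (top_of_set {0..1}) {t \<in> {0..1}. bond_param Y rv e t \<in> \<Union>K}"
    proof
      fix e assume "e \<in> arcs Y"
      with K have "openin (top_of_set {0..1})
        (\<Union>S\<in>K. {t \<in> {0..1}. bond_param Y rv e t \<in> S})"
        by (intro openin_Union) auto
      also have "(\<Union>S\<in>K. {t \<in> {0..1}. bond_param Y rv e t \<in> S})
        = {t \<in> {0..1}. bond_param Y rv e t \<in> \<Union>K}" by auto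
      finally show "openin (top_of_set {0..1}) {t \<in> {0..1}. bond_param Y rv e t \<in> \<Union>K}" .
    qed
  qed
  then show ?thesis
    unfolding realization_topology_def by (simp add: topology_inverse')
qed

lemma topspace_realization_topology:
  "topspace (realization_topology Y rv) = realization Y rv"
proof -
  have "openin (realization_topology Y rv) (realization Y rv)"
  proof (unfold openin_realization_topology, intro conjI ballI)
    fix e assume e: "e \<in> arcs Y"
    have "{t \<in> {0..1}. bond_param Y rv e t \<in> realization Y rv} = {0..1}"
      using e by (auto simp: bond_param_def realization_def realization_cells_def)
    then show "openin (top_of_set {0..1}) {t \<in> {0..1}. bond_param Y rv e t \<in> realization Y rv}"
      by simp
  qed simp
  moreover have "U \<subseteq> realization Y rv" if "openin (realization_topology Y rv) U" for U
    using that by (simp add: openin_realization_topology)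
  ultimately show ?thesis
    by (metis openin_subset openin_topspace subset_antisym)
qed

lemma homologous_refl [simp]: "homologous X arev u p p"
  by (simp add: homologous_def)

lemma homologous_sym: "homologous X arev u p q \<Longrightarrow> homologous X arev u q p"
  unfolding homologous_def by (rule equivclp_sym)

lemma homologous_trans:
  "homologous X arev u p q \<Longrightarrow> homologous X arev u q r \<Longrightarrow> homologous X arev u p r"
  unfolding homologous_def by (rule equivclp_trans)

lemma homology_class_eqI:
  "homologous X arev u p q \<Longrightarrow> homology_class X arev u p = homology_class X arev u q"
  unfolding homology_class_def using homologous_sym homologous_trans by fast

lemma homologous_some:
  "homologous X arev u p (SOME q. q \<in> homology_class X arev u p)"
proof -
  have "p \<in> homology_class X arev u p" by (simp add: homology_class_def)
  then have "(SOME q. q \<in> homology_class X arev u p) \<in> homology_class X arev u p" by (rule someI)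
  then show ?thesis by (simp add: homology_class_def)
qed

lemma equivclp_invariant:
  assumes "equivclp R x y" and "\<And>x y. R x y \<Longrightarrow> f x = f y"
  shows "f x = f y"
  using assms(1) by (induction rule: equivclp_induct) (auto dest: assms(2))

context bidirected_digraph
begin

lemma homology_move_awalk:
  assumes "homology_move G arev u p q"
  shows "awalk u p = awalk u q"
  using assms
proof cases
  case (backtrack p' e q' w)
  then have "e \<in> arcs G" "tail G e = awlast u p'" by (auto simp: awalk_Cons_iff)
  with backtrack show ?thesis by (auto simp: fun_eq_iff awalk_Cons_iff)
next
  case (swap p' v l m q' w)
  then have "awlast u p' = v" "awlast v l = v" "awlast v m = v" by auto
  with swap show ?thesis by (auto simp: fun_eq_iff)
qed

lemma homologous_awalk:
  assumes "homologous G arev u p q"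
  shows "awalk u p v \<longleftrightarrow> awalk u q v"
proof -
  have "awalk u p = awalk u q"
    using assms[unfolded homologous_def] homology_move_awalk by (rule equivclp_invariant)
  then show ?thesis by simp
qed

lemma homology_move_append:
  assumes "homology_move G arev u p q" and "awalk u p v" and "awalk v r w"
  shows "homology_move G arev u (p @ r) (q @ r)"
  using assms(1)
proof cases
  case (backtrack p' e q' w')
  have "awalk u (p' @ [e, arev e] @ q' @ r) w"
    using awalk_appendI[OF assms(2,3)] backtrack by (simp del: awalk_append_iff)
  then have "homology_move G arev u (p' @ [e, arev e] @ q' @ r) (p' @ q' @ r)"
    by (rule homology_move.backtrack[of G u p' e arev "q' @ r" w])
  then show ?thesis using backtrack by simp
next
  case (swap p' v' l m q' w')
  then have l: "awlast u p' = v'" "awlast v' l = v'" "awlast v' m = v'" by auto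
  have "awalk v' q' v" using assms(2) l swap by auto
  then have "awalk v' (q' @ r) w" using assms(3) by (rule awalk_appendI)
  then show ?thesis using homology_move.swap[of G u p' v' l m "q' @ r"] swap by simp
qed

lemma homologous_append:
  assumes "homologous G arev u p q" and "awalk u p v" and "awalk v r w"
  shows "homologous G arev u (p @ r) (q @ r)"
  using assms(1) unfolding homologous_def
proof (induction rule: equivclp_induct)
  case base
  show ?case by simp
next
  case (step y z)
  have "homologous G arev u p y" "homologous G arev u p z"
    unfolding homologous_def by (fact step(1)) (rule equivclp_into_equivclp[OF step(1,2)])
  then have "awalk u y v" "awalk u z v" using assms(2) homologous_awalk by blast+
  with step(2) have "homology_move G arev u (y @ r) (z @ r) \<or> homology_move G arev u (z @ r) (y @ r)"
    using homology_move_append[OF _ _ assms(3)] \<open>awalk u y v\<close> \<open>awalk u z v\<close> by metis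
  with step(3) show ?case by (rule equivclp_into_equivclp)
qed

lemma some_homology_class_awalk:
  assumes "awalk u p v"
  shows "awalk u (SOME q. q \<in> homology_class G arev u p) v"
  using assms homologous_awalk[OF homologous_some] by blast

lemma cover_head_homology_class:
  assumes "awalk x0 p (tail G e)" and "e \<in> arcs G"
  shows "cover_head G arev x0 (homology_class G arev x0 p, e) = homology_class G arev x0 (p @ [e])"
proof -
  have "awalk (tail G e) [e] (head G e)" using assms(2) by (rule arc_implies_awalk)
  from homology_class_eqI[OF homologous_append[OF homologous_some assms(1) this]] show ?thesis
    by (simp only: cover_head_def prod.case)
qed

lemma cover_head_rev:
  assumes "awalk x0 p (tail G e)" and "e \<in> arcs G"
  shows "cover_head G arev x0 (homology_class G arev x0 (p @ [e]), arev e) = homology_class G arev x0 p"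
proof -
  have p: "awalk x0 (p @ [e]) (tail G (arev e))"
    using awalk_appendI[OF assms(1) arc_implies_awalk[OF assms(2)]] assms(2)
    by (simp del: awalk_append_iff)
  then have "awalk x0 (p @ [e, arev e] @ []) (head G (arev e))"
    using awalk_appendI[OF p arc_implies_awalk[of "arev e"]] assms(2)
    by (simp del: awalk_append_iff tail_arev head_arev)
  then have "homology_move G arev x0 (p @ [e, arev e] @ []) (p @ [])"
    by (rule homology_move.backtrack[of G x0 p e arev "[]" "head G (arev e)"])
  then have "homologous G arev x0 (p @ [e, arev e]) p"
    unfolding homologous_def by (simp add: r_into_equivclp)
  from homology_class_eqI[OF this] show ?thesis
    using cover_head_homology_class[OF p] assms(2) by simp
qed

lemma bidirected_digraph_cover:
  "bidirected_digraph (max_abelian_cover G arev x0) (cover_rev G arev x0)"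
proof -
  let ?C = "max_abelian_cover G arev x0" and ?r = "cover_rev G arev x0"
  have arc: "fst b \<in> atoms G arev x0 \<and> cover_head G arev x0 b \<in> atoms G arev x0 \<and>
      ?r b \<in> cover_arcs G arev x0 \<and> ?r b \<noteq> b \<and> ?r (?r b) = b \<and>
      fst (?r b) = cover_head G arev x0 b"
    if "b \<in> cover_arcs G arev x0" for b
  proof -
    from that obtain p e where b: "b = (homology_class G arev x0 p, e)" "e \<in> arcs G"
      and p: "awalk x0 p (tail G e)" unfolding cover_arcs_def by auto
    have pe: "awalk x0 (p @ [e]) (tail G (arev e))"
      using awalk_appendI[OF p arc_implies_awalk[OF b(2)]] b(2) by (simp del: awalk_append_iff)
    have hd: "cover_head G arev x0 b = homology_class G arev x0 (p @ [e])"
      using cover_head_homology_class p b by simp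
    have r: "?r b = (homology_class G arev x0 (p @ [e]), arev e)"
      using that hd b by (simp add: cover_rev_def)
    have r_in: "?r b \<in> cover_arcs G arev x0"
      unfolding r cover_arcs_def using pe b(2) arev_in_arcs[OF b(2)] by blast
    have "?r (?r b) = b"
      using r_in r cover_head_rev[OF p b(2)] b by (simp add: cover_rev_def)
    moreover have "?r b \<noteq> b" using r b arev_neq by auto
    moreover have "fst b \<in> atoms G arev x0" using b p unfolding atoms_def by auto
    moreover have "cover_head G arev x0 b \<in> atoms G arev x0"
      unfolding hd atoms_def using pe by blast
    ultimately show ?thesis using r_in r hd by simp
  qed
  show ?thesis
  proof
    show "\<And>e. e \<in> arcs ?C \<Longrightarrow> tail ?C e \<in> verts ?C" "\<And>e. e \<in> arcs ?C \<Longrightarrow> head ?C e \<in> verts ?C"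
      "\<And>a. a \<in> arcs ?C \<Longrightarrow> ?r (?r a) = a" "\<And>a. a \<in> arcs ?C \<Longrightarrow> tail ?C (?r a) = head ?C a"
      using arc by (simp_all add: max_abelian_cover_def)
    show "\<And>a. a \<in> arcs ?C \<longleftrightarrow> ?r a \<noteq> a"
      using arc by (auto simp: max_abelian_cover_def cover_rev_def)
  qed
qed

lemma homologous_path_chain:
  assumes "homologous G arev u p q"
  shows "path_chain arev p = path_chain arev q"
  using assms unfolding homologous_def
proof (rule equivclp_invariant)
  fix p q assume "homology_move G arev u p q"
  then show "path_chain arev p = path_chain arev q"
    by cases (simp_all add: path_chain_def edge_chain_def)
qed

lemma atom_map_homology_class:
  "atom_map G arev (homology_class G arev x0 p) = cycle_proj G arev (path_chain arev p)"
  unfolding atom_map_def by (simp flip: homologous_path_chain[OF homologous_some])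

lemma arev_inject: "arev e = arev f \<longleftrightarrow> e = f"
  by (metis arev_arev)

lemma lookup_edge_chain:
  "Poly_Mapping.lookup (edge_chain arev e) f = (if f = e then 1 else 0) - (if f = arev e then 1 else 0)"
  by (auto simp: edge_chain_def lookup_minus lookup_single when_def)

lemma edge_chain_in_chains:
  assumes "e \<in> arcs G"
  shows "edge_chain arev e \<in> chains G arev" and "edge_chain arev (arev e) = - edge_chain arev e"
proof -
  show "edge_chain arev (arev e) = - edge_chain arev e" by (simp add: edge_chain_def)
  have "Poly_Mapping.keys (edge_chain arev e) \<subseteq> arcs G"
    using assms by (auto simp: in_keys_iff lookup_edge_chain split: if_splits)
  moreover have "f = arev e" if "arev f = e" for f using that by auto
  ultimately show "edge_chain arev e \<in> chains G arev"
    by (auto simp: chains_def lookup_edge_chain arev_inject)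
qed

lemma keys_edge_chain: "e \<in> arcs G \<Longrightarrow> Poly_Mapping.keys (edge_chain arev e) = {e, arev e}"
  using arev_neq[of e] by (auto simp: in_keys_iff lookup_edge_chain split: if_splits)

lemma boundary_edge_chain:
  assumes "e \<in> arcs G"
  shows "boundary G (edge_chain arev e) =
    Poly_Mapping.single (head G e) 1 - Poly_Mapping.single (tail G e) 1"
proof -
  have half: "(1/2) *\<^sub>R (a - b) - (1/2) *\<^sub>R (b - a) = a - b" for a b :: "'a \<Rightarrow>\<^sub>0 real"
  proof -
    have "(1/2) *\<^sub>R (a - b) - (1/2) *\<^sub>R (b - a) = (1/2) *\<^sub>R ((a - b) - (b - a))"
      by (simp only: scaleR_diff_right)
    also have "(a - b) - (b - a) = (a - b) + (a - b)" by simp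
    finally show ?thesis by (simp only: scaleR_half_double)
  qed
  show ?thesis
    using arev_neq[OF assms] arev_neq[OF assms, symmetric] assms
    by (simp add: boundary_def keys_edge_chain lookup_edge_chain half)
qed

lemma chain_inner_edge_chain:
  assumes "e \<in> arcs G"
  shows "chain_inner (edge_chain arev e) (edge_chain arev f) =
    (if f = e then 1 else if f = arev e then -1 else 0)"
  using arev_neq[OF assms] arev_neq[OF assms, symmetric] assms
  by (auto simp: chain_inner_def keys_edge_chain lookup_edge_chain arev_inject)

text \<open>\<open>chains\<close> is the quotient of the real vector space on the edges by the relations
  \<open>e\<^sup>-\<^sup>1 = -e\<close>, the class of a combination of edges being its \<open>edge_combination\<close>.\<close>

definition edge_combination :: "('b \<Rightarrow>\<^sub>0 real) \<Rightarrow> ('b \<Rightarrow>\<^sub>0 real)" where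
  "edge_combination c = (\<Sum>e\<in>Poly_Mapping.keys c. Poly_Mapping.lookup c e *\<^sub>R edge_chain arev e)"

lemma lookup_scaleR: "Poly_Mapping.lookup (r *\<^sub>R c) x = r * Poly_Mapping.lookup c x"
  for c :: "'b \<Rightarrow>\<^sub>0 real"
proof -
  have "{x. r *\<^sub>R Poly_Mapping.lookup c x \<noteq> 0} \<subseteq> {x. Poly_Mapping.lookup c x \<noteq> 0}" by auto
  then have "finite {x. r *\<^sub>R Poly_Mapping.lookup c x \<noteq> 0}"
    by (rule finite_subset) (rule finite_lookup)
  then show ?thesis by (simp add: scaleR_poly_mapping_def Abs_poly_mapping_inverse)
qed

lemma lookup_edge_combination:
  "Poly_Mapping.lookup (edge_combination c) f =
     Poly_Mapping.lookup c f - Poly_Mapping.lookup c (arev f)"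
proof -
  have "Poly_Mapping.lookup (edge_combination c) f =
    (\<Sum>e\<in>Poly_Mapping.keys c. (if e = f then Poly_Mapping.lookup c e else 0)) -
    (\<Sum>e\<in>Poly_Mapping.keys c. (if e = arev f then Poly_Mapping.lookup c e else 0))"
    unfolding edge_combination_def lookup_sum lookup_scaleR sum_subtractf[symmetric]
    by (intro sum.cong) (auto simp: lookup_edge_chain)
  then show ?thesis by (simp add: in_keys_iff)
qed

lemma linear_edge_combination: "linear edge_combination"
  by (intro linearI poly_mapping_eqI)
    (simp_all add: lookup_edge_combination lookup_add lookup_scaleR algebra_simps)

lemma chains_eq_image: "chains G arev = edge_combination ` {c. Poly_Mapping.keys c \<subseteq> arcs G}"
proof (intro equalityI subsetI)
  fix c assume c: "c \<in> chains G arev"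
  have *: "Poly_Mapping.lookup c (arev f) = - Poly_Mapping.lookup c f" for f
  proof (cases "f \<in> arcs G")
    case False
    then have "f \<notin> Poly_Mapping.keys c" using c by (auto simp: chains_def)
    then show ?thesis using False by (simp add: arev_eq in_keys_iff)
  qed (use c in \<open>simp add: chains_def\<close>)
  have "c = edge_combination ((1/2) *\<^sub>R c)"
    by (rule poly_mapping_eqI) (simp add: lookup_edge_combination lookup_scaleR *)
  moreover have "Poly_Mapping.keys ((1/2) *\<^sub>R c) \<subseteq> arcs G"
    using c by (auto simp: in_keys_iff lookup_scaleR chains_def)
  ultimately show "c \<in> edge_combination ` {c. Poly_Mapping.keys c \<subseteq> arcs G}" by blast
next
  fix d assume "d \<in> edge_combination ` {c. Poly_Mapping.keys c \<subseteq> arcs G}"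
  then obtain c where c: "Poly_Mapping.keys c \<subseteq> arcs G" "d = edge_combination c" by auto
  have "f \<in> arcs G" if "f \<in> Poly_Mapping.keys d" for f
    using that arev_eq[of f] by (cases "f \<in> arcs G") (auto simp: c(2) in_keys_iff lookup_edge_combination)
  then show "d \<in> chains G arev" by (auto simp: chains_def c(2) lookup_edge_combination)
qed

lemma edge_relations_kernel:
  assumes "Poly_Mapping.keys c \<subseteq> arcs G"
  shows "edge_combination c = 0 \<longleftrightarrow>
    c \<in> span {Poly_Mapping.single (arev e) 1 + Poly_Mapping.single e 1 | e. e \<in> arcs G}"
    (is "_ \<longleftrightarrow> c \<in> span ?R")
proof
  assume 0: "edge_combination c = 0"
  have sym: "Poly_Mapping.lookup c (arev f) = Poly_Mapping.lookup c f" for f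
    using lookup_edge_combination[of c f] by (simp add: 0)
  let ?s = "\<Sum>e\<in>Poly_Mapping.keys c. (Poly_Mapping.lookup c e / 2) *\<^sub>R
    (Poly_Mapping.single (arev e) 1 + Poly_Mapping.single e (1::real))"
  have "c = ?s"
  proof (rule poly_mapping_eqI)
    fix f
    have "Poly_Mapping.lookup ?s f =
      (\<Sum>e\<in>Poly_Mapping.keys c. (if e = arev f then Poly_Mapping.lookup c e / 2 else 0)) +
      (\<Sum>e\<in>Poly_Mapping.keys c. (if e = f then Poly_Mapping.lookup c e / 2 else 0))"
      unfolding lookup_sum lookup_scaleR lookup_add sum.distrib[symmetric]
      by (intro sum.cong) (auto simp: lookup_single when_def)
    then show "Poly_Mapping.lookup c f = Poly_Mapping.lookup ?s f"
      by (simp add: in_keys_iff sym)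
  qed
  moreover have "?s \<in> span ?R" using assms by (intro span_sum span_scale span_base) auto
  ultimately show "c \<in> span ?R" by simp
next
  assume "c \<in> span ?R"
  moreover have "edge_combination r = 0" if "r \<in> ?R" for r
    using that by (auto intro!: poly_mapping_eqI
        simp: lookup_edge_combination lookup_add lookup_single when_def arev_inject)
  ultimately show "edge_combination c = 0"
    using linear_eq_0_on_span[OF linear_edge_combination] by blast
qed

end

end

theory Submission
  imports Defs
begin

text \<open>
  Existence and uniqueness. An affine function on a bond is determined by its values at the two ends.
  Since \<open>i(\<lbrakk>p e\<rbrakk>) - i(\<lbrakk>p\<rbrakk>) = \<pi>(e)\<close>, the value of \<open>j\<close> at parameter \<open>t\<close> on the bond
  \<open>(\<lbrakk>p\<rbrakk>, e)\<close> has to be \<open>i(\<lbrakk>p\<rbrakk>) + t \<pi>(e)\<close>. This formula respects the gluing, so that being an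
  affine extension amounts to being given by it (\<open>affine_extension_iff\<close>). Continuity is then clear on
  each bond.
  
  Injectivity. Let two points of the cover lie at parameter \<open>t\<close> on \<open>(\<lbrakk>p\<rbrakk>, e)\<close> and at parameter \<open>s\<close>
  on \<open>(\<lbrakk>q\<rbrakk>, f)\<close>, and consider the real chain \<open>c = (c\<^sub>p + t e) - (c\<^sub>q + s f)\<close>. The points have the
  same image iff \<open>c\<close> is orthogonal to all cycles. The claim is that then \<open>c = 0\<close> if there are no
  bridges (\<open>bridgeless_orthogonal_imp_zero\<close>).
  
  A chain orthogonal to all cycles is the gradient of a potential \<open>\<phi>\<close> on the vertices. If \<open>c \<noteq> 0\<close>,
  choose an edge \<open>g\<close> with \<open>c(g) > 0\<close> and let \<open>S\<close> be the set of vertices with potential above that of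
  the tail of \<open>g\<close>. Then \<open>c\<close> is positive on every edge entering \<open>S\<close>. On the other hand \<open>c\<close> is a flow
  of one unit from the second point to the first, so it carries at most one unit into \<open>S\<close>, and it is
  integral away from \<open>e\<close> and \<open>f\<close>. If \<open>g\<close> is neither \<open>e\<close> nor \<open>f\<close> up to inversion, then \<open>c(g) \<ge> 1\<close>,
  so that \<open>g\<close> alone accounts for the whole flow into \<open>S\<close>; a closer look at the fractional parts shows
  the same in the other cases. But since \<open>g\<close> is not a bridge, a second edge enters \<open>S\<close>, a contradiction.
  
  It remains to recover the points from \<open>c = 0\<close> (\<open>cover_point_eq_if_chain_eq\<close>). By integrality,
  either both points are vertices or, after inverting \<open>f\<close> if necessary, \<open>e = f\<close> and \<open>t = s\<close>. In both
  cases there are two paths with the same chain, and paths from \<open>x0\<close> with the same chain are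
  homologous (\<open>homologous_iff_path_chain_eq\<close>).
\<close>

context bidirected_digraph
begin

section \<open>The inner product on chains\<close>

lemma chain_inner_superset:
  assumes "finite A" and "Poly_Mapping.keys c \<subseteq> A"
  shows "chain_inner c d = (\<Sum>e\<in>A. Poly_Mapping.lookup c e * Poly_Mapping.lookup d e) / 2"
  unfolding chain_inner_def
  using assms by (intro arg_cong2[where f = "(/)"] sum.mono_neutral_left refl) (auto simp: in_keys_iff)

lemma chain_inner_commute: "chain_inner c d = chain_inner d c"
proof -
  let ?A = "Poly_Mapping.keys c \<union> Poly_Mapping.keys d"
  have "chain_inner c d = (\<Sum>e\<in>?A. Poly_Mapping.lookup c e * Poly_Mapping.lookup d e) / 2"
    "chain_inner d c = (\<Sum>e\<in>?A. Poly_Mapping.lookup d e * Poly_Mapping.lookup c e) / 2"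
    by (intro chain_inner_superset; simp)+
  then show ?thesis by (simp add: mult.commute)
qed

lemma linear_chain_inner: "linear (chain_inner c)" for c :: "'b \<Rightarrow>\<^sub>0 real"
proof (rule linearI)
  show "chain_inner c (d + d') = chain_inner c d + chain_inner c d'" for d d'
    by (simp add: chain_inner_def lookup_add distrib_left sum.distrib add_divide_distrib)
  show "chain_inner c (r *\<^sub>R d) = r *\<^sub>R chain_inner c d" for r d
    by (simp add: chain_inner_def lookup_scaleR sum_distrib_left mult.left_commute)
qed

lemmas chain_inner_right =
  linear_add[OF linear_chain_inner] linear_diff[OF linear_chain_inner]
  linear_scale[OF linear_chain_inner] linear_0[OF linear_chain_inner]

lemma chain_inner_left:
  "chain_inner (c + d) w = chain_inner c w + chain_inner d w"
  "chain_inner (c - d) w = chain_inner c w - chain_inner d w"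
  "chain_inner (r *\<^sub>R c) w = r * chain_inner c w"
  for c d w :: "'b \<Rightarrow>\<^sub>0 real"
  by (simp_all add: chain_inner_commute[of _ w] chain_inner_right)

lemma chain_inner_self_eq_0: "chain_inner c c = 0 \<longleftrightarrow> c = 0"
proof
  assume "chain_inner c c = 0"
  then have "\<forall>e\<in>Poly_Mapping.keys c. Poly_Mapping.lookup c e * Poly_Mapping.lookup c e = 0"
    unfolding chain_inner_def by (subst sum_nonneg_eq_0_iff[symmetric]) auto
  then show "c = 0" by (auto intro!: poly_mapping_eqI simp: in_keys_iff)
qed (simp add: chain_inner_def)

text \<open>
  The coordinates of a chain are its inner products with the edges; the factor \<open>1/2\<close> in the inner
  product compensates for the two equal contributions of an edge and its inverse.
\<close>

lemma chain_inner_edge_chain_right: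
  assumes "c \<in> chains G arev" and "e \<in> arcs G"
  shows "chain_inner c (edge_chain arev e) = Poly_Mapping.lookup c e"
proof -
  have "chain_inner c (edge_chain arev e) = chain_inner (edge_chain arev e) c"
    by (rule chain_inner_commute)
  also have "\<dots> = Poly_Mapping.lookup c e"
    using assms arev_neq[OF assms(2)] arev_neq[OF assms(2), symmetric]
    by (simp add: chain_inner_def keys_edge_chain lookup_edge_chain chains_def)
  finally show ?thesis .
qed

text \<open>
  The space of all chains may be infinite-dimensional and incomplete, so the projection onto a
  finite-dimensional subspace is built by a Gram--Schmidt step for each spanning vector.
\<close>

lemma orthogonal_projection_exists:
  fixes B :: "('b \<Rightarrow>\<^sub>0 real) set"
  assumes "finite B"
  shows "\<exists>z\<in>span B. \<forall>w\<in>span B. chain_inner (c - z) w = 0"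
  using assms
proof (induction B arbitrary: c)
  case empty
  show ?case by (auto simp: chain_inner_right)
next
  case (insert b B)
  obtain pc where pc: "pc \<in> span B" "\<And>w. w \<in> span B \<Longrightarrow> chain_inner (c - pc) w = 0"
    using insert.IH[of c] by blast
  obtain pb where pb: "pb \<in> span B" "\<And>w. w \<in> span B \<Longrightarrow> chain_inner (b - pb) w = 0"
    using insert.IH[of b] by blast
  \<comment> \<open>\<open>b'\<close> is the part of \<open>b\<close> orthogonal to \<open>span B\<close>; it vanishes if \<open>b\<close> is redundant, and then
    the default value \<open>r = 0\<close> of the division is harmless.\<close>
  define b' where "b' = b - pb"
  define r where "r = chain_inner c b' / chain_inner b' b'"
  define z where "z = pc + r *\<^sub>R b'"
  have mono: "x \<in> span (insert b B)" if "x \<in> span B" for x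
    using that span_mono[of B "insert b B"] by blast
  have b': "b' \<in> span (insert b B)"
    unfolding b'_def using mono[OF pb(1)] span_base[of b "insert b B"] by (simp add: span_diff)
  have z: "z \<in> span (insert b B)"
    unfolding z_def using mono[OF pc(1)] b' by (simp add: span_add span_scale)
  have zB: "chain_inner (c - z) w = 0" if "w \<in> span B" for w
    using pc(2)[OF that] pb(2)[OF that]
    by (simp add: z_def b'_def chain_inner_left algebra_simps)
  have "chain_inner (c - z) b' = 0"
  proof (cases "b' = 0")
    case False
    then have "chain_inner b' b' \<noteq> 0" by (simp add: chain_inner_self_eq_0)
    moreover have "chain_inner pc b' = 0"
      using pb(2)[OF pc(1)] by (simp add: b'_def chain_inner_commute)
    ultimately show ?thesis by (simp add: z_def r_def chain_inner_left)
  qed (simp add: chain_inner_right)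
  then have zb: "chain_inner (c - z) b = 0"
    using zB[OF pb(1)] by (simp add: b'_def chain_inner_right)
  have "chain_inner (c - z) w = 0" if "w \<in> span (insert b B)" for w
  proof -
    obtain k where "w - k *\<^sub>R b \<in> span B"
      using \<open>w \<in> span (insert b B)\<close> by (auto simp: span_insert)
    from zB[OF this] zb show ?thesis by (simp add: chain_inner_right)
  qed
  with z show ?case by blast
qed

lemma subspace_cycles:
  "finite_dimensional (cycles G arev) \<Longrightarrow> subspace (cycles G arev)"
  unfolding finite_dimensional_def by (metis subspace_span)

lemma cycle_proj_unique:
  assumes "finite_dimensional (cycles G arev)"
    and "z \<in> cycles G arev" and "\<And>w. w \<in> cycles G arev \<Longrightarrow> chain_inner (c - z) w = 0"
  shows "cycle_proj G arev c = z"
  unfolding cycle_proj_def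
proof (rule the_equality)
  show "z \<in> cycles G arev \<and> (\<forall>w\<in>cycles G arev. chain_inner (c - z) w = 0)"
    using assms by blast
  fix y assume y: "y \<in> cycles G arev \<and> (\<forall>w\<in>cycles G arev. chain_inner (c - y) w = 0)"
  have yz: "y - z \<in> cycles G arev"
    using subspace_cycles[OF assms(1)] y assms(2) by (simp add: subspace_diff)
  have "chain_inner (y - z) (y - z) = 0"
    using y assms(3)[OF yz] yz by (simp add: chain_inner_left)
  then show "y = z" by (simp add: chain_inner_self_eq_0)
qed

lemma
  assumes "finite_dimensional (cycles G arev)"
  shows cycle_proj_in_cycles: "cycle_proj G arev c \<in> cycles G arev"
    and cycle_proj_orthogonal:
      "w \<in> cycles G arev \<Longrightarrow> chain_inner (c - cycle_proj G arev c) w = 0"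
proof -
  obtain z where z: "z \<in> cycles G arev" "\<And>w. w \<in> cycles G arev \<Longrightarrow> chain_inner (c - z) w = 0"
    using assms orthogonal_projection_exists unfolding finite_dimensional_def by metis
  note eq = cycle_proj_unique[OF assms z]
  show "cycle_proj G arev c \<in> cycles G arev" using z by (simp add: eq)
  show "w \<in> cycles G arev \<Longrightarrow> chain_inner (c - cycle_proj G arev c) w = 0"
    using z by (simp add: eq)
qed

lemma linear_cycle_proj:
  assumes "finite_dimensional (cycles G arev)"
  shows "linear (cycle_proj G arev)"
proof (rule linearI)
  note sub = subspace_cycles[OF assms] and orth = cycle_proj_orthogonal[OF assms]
  show "cycle_proj G arev (c + d) = cycle_proj G arev c + cycle_proj G arev d" for c d
    using orth[of _ c] orth[of _ d] subspace_add[OF sub cycle_proj_in_cycles cycle_proj_in_cycles]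
    by (intro cycle_proj_unique assms) (auto simp: chain_inner_left assms)
  show "cycle_proj G arev (r *\<^sub>R c) = r *\<^sub>R cycle_proj G arev c" for r c
    using orth[of _ c] subspace_scale[OF sub cycle_proj_in_cycles]
    by (intro cycle_proj_unique assms) (auto simp: chain_inner_left assms)
qed

section \<open>Chains of paths\<close>

lemma path_chain_simps [simp]:
  "path_chain arev [] = 0"
  "path_chain arev (e # p) = edge_chain arev e + path_chain arev p"
  "path_chain arev (p @ q) = path_chain arev p + path_chain arev q"
  by (simp_all add: path_chain_def)

lemma edge_chain_arev [simp]: "edge_chain arev (arev e) = - edge_chain arev e"
  by (simp add: edge_chain_def)

lemma path_chain_rev [simp]: "path_chain arev (map arev (rev p)) = - path_chain arev p"
  by (induction p) auto

lemma lookup_path_chain: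
  "Poly_Mapping.lookup (path_chain arev p) e = real (count_list p e) - real (count_list p (arev e))"
  by (induction p) (auto simp: lookup_add lookup_edge_chain)

lemma subspace_chains: "subspace (chains G arev)"
proof (rule subspaceI)
  fix c d assume "c \<in> chains G arev" "d \<in> chains G arev"
  then show "c + d \<in> chains G arev"
    using keys_add[of c d] by (auto simp: chains_def lookup_add)
qed (auto simp: chains_def lookup_scaleR in_keys_iff)

lemma path_chain_in_chains: "set p \<subseteq> arcs G \<Longrightarrow> path_chain arev p \<in> chains G arev"
  by (induction p)
    (auto simp: subspace_0 subspace_add subspace_chains edge_chain_in_chains)

lemma boundary_superset:
  assumes "finite A" and "Poly_Mapping.keys c \<subseteq> A"
  shows "boundary G c = (\<Sum>e\<in>A. (Poly_Mapping.lookup c e / 2) *\<^sub>R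
     (Poly_Mapping.single (head G e) 1 - Poly_Mapping.single (tail G e) 1))"
  unfolding boundary_def
  using assms by (intro sum.mono_neutral_left) (auto simp: in_keys_iff)

lemma boundary_add: "boundary G (c + d) = boundary G c + boundary G d"
proof -
  let ?A = "Poly_Mapping.keys c \<union> Poly_Mapping.keys d"
  have "Poly_Mapping.keys (c + d) \<subseteq> ?A" by (rule keys_add)
  then show ?thesis
    by (simp add: boundary_superset[of ?A] lookup_add add_divide_distrib scaleR_left_distrib
        sum.distrib)
qed

lemma boundary_diff: "boundary G (c - d) = boundary G c - boundary G d"
  using boundary_add[of "c - d" d] by simp

lemma boundary_path_chain:
  "awalk u p v \<Longrightarrow>
    boundary G (path_chain arev p) = Poly_Mapping.single v 1 - Poly_Mapping.single u 1"
  by (induction p arbitrary: u)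
    (auto simp: awalk_simps boundary_add boundary_edge_chain boundary_def[of G 0])

lemma path_chain_diff_in_cycles:
  assumes "awalk u p v" and "awalk u q v"
  shows "path_chain arev p - path_chain arev q \<in> cycles G arev"
  unfolding cycles_def mem_Collect_eq
proof
  show "path_chain arev p - path_chain arev q \<in> chains G arev"
    using assms by (intro subspace_diff[OF subspace_chains] path_chain_in_chains) auto
  show "boundary G (path_chain arev p - path_chain arev q) = 0"
    using assms by (simp add: boundary_diff boundary_path_chain)
qed

text \<open>
  The boundary of the chain of a path records its end points.
\<close>

lemma path_chain_eq_imp_same_end:
  assumes "awalk u p v" and "awalk u q w" and "path_chain arev p = path_chain arev q"
  shows "v = w"
proof -
  have "Poly_Mapping.single v (1::real) = Poly_Mapping.single w 1"
    using boundary_path_chain[OF assms(1)] boundary_path_chain[OF assms(2)] assms(3) by simp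
  then have "Poly_Mapping.lookup (Poly_Mapping.single w (1::real)) v = 1"
    by (metis lookup_single_eq)
  then show ?thesis by (simp add: lookup_single when_def split: if_splits)
qed

section \<open>Paths with equal chains are homologous\<close>

lemma awalk_rev: "awalk u p v \<Longrightarrow> awalk v (map arev (rev p)) u"
proof (induction p arbitrary: u)
  case (Cons e p)
  then have e: "e \<in> arcs G" "u = tail G e" "awalk v (map arev (rev p)) (head G e)"
    by (auto simp: awalk_Cons_iff)
  have "awalk (head G e) [arev e] u"
    using arc_implies_awalk[of "arev e"] e by simp
  from awalk_appendI[OF e(3) this] show ?case by simp
qed (auto simp: awalk_Nil_iff)

lemma homology_move_prepend:
  assumes "homology_move G arev v p q" and "awalk u a v"
  shows "homology_move G arev u (a @ p) (a @ q)"
  using assms(1)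
proof cases
  case (backtrack p' e q' w)
  then have "awalk u ((a @ p') @ [e, arev e] @ q') w"
    using awalk_appendI[OF assms(2) backtrack(3)] by simp
  from homology_move.backtrack[of G u "a @ p'" e arev q' w, OF this] show ?thesis using backtrack by simp
next
  case (swap p' v' l m q' w)
  from homology_move.swap[OF awalk_appendI[OF assms(2) swap(3)] swap(4-6)]
  show ?thesis using swap by simp
qed

lemma homologous_prepend:
  assumes "homologous G arev v p q" and "awalk u a v"
  shows "homologous G arev u (a @ p) (a @ q)"
  using assms(1) unfolding homologous_def
proof (induction rule: equivclp_induct)
  case (step y z)
  from step(2) have "homology_move G arev u (a @ y) (a @ z) \<or> homology_move G arev u (a @ z) (a @ y)"
    using homology_move_prepend[OF _ assms(2)] by blast
  with step(3) show ?case by (rule equivclp_into_equivclp)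
qed simp

lemma homologous_rev_cancel:
  assumes "awalk u p v"
  shows "homologous G arev u (p @ map arev (rev p)) []"
  using assms
proof (induction p arbitrary: u)
  case (Cons e p)
  then have e: "e \<in> arcs G" "u = tail G e" "awalk (head G e) p v"
    by (auto simp: awalk_Cons_iff)
  have e1: "awalk u [e] (head G e)" and e2: "awalk (head G e) [arev e] u"
    using arc_implies_awalk[OF e(1)] arc_implies_awalk[of "arev e"] e by auto
  have w: "awalk (head G e) (p @ map arev (rev p)) (head G e)"
    using awalk_appendI[OF e(3) awalk_rev[OF e(3)]] .
  have "homologous G arev (head G e) ((p @ map arev (rev p)) @ [arev e]) ([] @ [arev e])"
    by (rule homologous_append[OF Cons.IH[OF e(3)] w e2])
  from homologous_prepend[OF this e1]
  have "homologous G arev u (e # (p @ map arev (rev p)) @ [arev e]) [e, arev e]" by simp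
  moreover have "homologous G arev u [e, arev e] []"
    unfolding homologous_def
    using homology_move.backtrack[of G u "[]" e arev "[]" u] awalk_appendI[OF e1 e2]
    by (auto intro: r_into_equivclp)
  ultimately show ?case using homologous_trans[of G arev u "e # p @ map arev (rev p) @ [arev e]"] by simp
qed simp

lemma homologous_rev_cancel':
  assumes "awalk u p v"
  shows "homologous G arev v (map arev (rev p) @ p) []"
  using homologous_rev_cancel[OF awalk_rev[OF assms]] by (simp add: rev_map comp_def)

text \<open>
  Here \<open>\<tau> v\<close> is a chosen path from a fixed vertex \<open>u\<close> to \<open>v\<close>. Conjugating by it turns each edge into
  a loop at \<open>u\<close>, and loops at the same vertex commute up to homology. This makes the order of the
  edges of a path irrelevant, whereas the edges themselves are not loops and cannot be swapped.
\<close>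

definition based_loop :: "('a \<Rightarrow> 'b list) \<Rightarrow> 'b \<Rightarrow> 'b list" where
  "based_loop \<tau> e = \<tau> (tail G e) @ [e] @ map arev (rev (\<tau> (head G e)))"

lemma awalk_based_loop:
  assumes "\<And>v. v \<in> verts G \<Longrightarrow> awalk u (\<tau> v) v" and "e \<in> arcs G"
  shows "awalk u (based_loop \<tau> e) u"
  unfolding based_loop_def
  using assms by (intro awalk_appendI[where v = "tail G e"] awalk_appendI[where v = "head G e"]
      awalk_rev arc_implies_awalk) auto

lemma awalk_based_loops:
  assumes "\<And>v. v \<in> verts G \<Longrightarrow> awalk u (\<tau> v) v" and "u \<in> verts G" and "set es \<subseteq> arcs G"
  shows "awalk u (concat (map (based_loop \<tau>) es)) u"
  using assms(3)
proof (induction es)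
  case (Cons e es)
  have "awalk u (based_loop \<tau> e) u" by (rule awalk_based_loop) (use assms Cons.prems in auto)
  then show ?case using awalk_appendI Cons by simp
qed (use assms(2) in \<open>simp add: awalk_Nil_iff\<close>)

text \<open>
  Replacing each edge of \<open>p\<close> by its based loop inserts the words \<open>\<tau>(w)\<^sup>-\<^sup>1 \<tau>(w)\<close> at the intermediate
  vertices \<open>w\<close>, and these cancel.
\<close>

lemma homologous_based_loops:
  assumes \<tau>: "\<And>v. v \<in> verts G \<Longrightarrow> awalk u (\<tau> v) v" and "u \<in> verts G" and "awalk v p w"
  shows "homologous G arev u (\<tau> v @ p) (concat (map (based_loop \<tau>) p) @ \<tau> w)"
  using assms(3)
proof (induction p arbitrary: v)
  case Nil
  then show ?case by (auto simp: awalk_Nil_iff)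
next
  case (Cons e p)
  let ?h = "head G e"
  have e: "e \<in> arcs G" "v = tail G e" "awalk ?h p w" using Cons.prems by (auto simp: awalk_Cons_iff)
  then have h: "?h \<in> verts G" and t: "tail G e \<in> verts G" by auto
  have loop: "awalk u (based_loop \<tau> e) u" by (rule awalk_based_loop[OF \<tau> e(1)])
  have te: "awalk u (\<tau> v @ [e]) ?h"
    using \<tau>[OF t] e arc_implies_awalk by (blast intro: awalk_appendI)
  have rr: "awalk ?h (map arev (rev (\<tau> ?h)) @ \<tau> ?h) ?h"
    using \<tau>[OF h] awalk_rev awalk_appendI by blast
  have 1: "homologous G arev u (based_loop \<tau> e @ \<tau> ?h @ p)
      (based_loop \<tau> e @ concat (map (based_loop \<tau>) p) @ \<tau> w)"
    by (rule homologous_prepend[OF Cons.IH[OF e(3)] loop])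
  have "homologous G arev ?h ((map arev (rev (\<tau> ?h)) @ \<tau> ?h) @ p) ([] @ p)"
    by (rule homologous_append[OF homologous_rev_cancel'[OF \<tau>[OF h]] rr e(3)])
  from homologous_prepend[OF this te]
  have 2: "homologous G arev u (based_loop \<tau> e @ \<tau> ?h @ p) (\<tau> v @ e # p)"
    using e(2) by (simp add: based_loop_def)
  from homologous_trans[OF homologous_sym[OF 2] 1] show ?case by simp
qed

text \<open>
  If the chain vanishes, the first edge \<open>e\<close> of the word has a partner \<open>e\<^sup>-\<^sup>1\<close> later on. The based loop of
  the partner is the inverse of the one of \<open>e\<close>; it can be commuted next to it and cancelled. The
  remaining word is shorter and still has vanishing chain. The word \<open>es\<close> is an arbitrary list of
  edges, since deleting \<open>e\<close> and \<open>e\<^sup>-\<^sup>1\<close> does not preserve paths.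
\<close>

lemma based_loops_trivial:
  assumes \<tau>: "\<And>v. v \<in> verts G \<Longrightarrow> awalk u (\<tau> v) v" and u: "u \<in> verts G"
    and "set es \<subseteq> arcs G" and "path_chain arev es = 0"
  shows "homologous G arev u (concat (map (based_loop \<tau>) es)) []"
  using assms(3,4)
proof (induction es rule: length_induct)
  case (1 es)
  let ?L = "\<lambda>es. concat (map (based_loop \<tau>) es)"
  have L: "awalk u (?L es) u" if "set es \<subseteq> arcs G" for es
    using \<tau> u that by (rule awalk_based_loops)
  show ?case
  proof (cases es)
    case Nil
    then show ?thesis by simp
  next
    case (Cons e es')
    have e: "e \<in> arcs G" using 1 Cons by auto
    have "count_list es' (arev e) > 0"
    proof (rule ccontr)
      assume "\<not> ?thesis"
      then have "Poly_Mapping.lookup (path_chain arev es) e > 0"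
        using arev_neq[OF e] by (simp add: lookup_path_chain Cons del: path_chain_simps)
      then show False using 1 by simp
    qed
    then have "arev e \<in> set es'" by (metis count_notin less_irrefl)
    then obtain a b where ab: "es' = a @ arev e # b" by (metis split_list)
    have sub: "set a \<subseteq> arcs G" "set b \<subseteq> arcs G" "set (a @ b) \<subseteq> arcs G"
      using 1 Cons ab by auto
    have le: "awalk u (based_loop \<tau> e) u" "awalk u (based_loop \<tau> (arev e)) u"
      using awalk_based_loop[OF \<tau>] e by auto
    have "homology_move G arev u (based_loop \<tau> e @ ?L a @ based_loop \<tau> (arev e) @ ?L b)
        (based_loop \<tau> e @ based_loop \<tau> (arev e) @ ?L a @ ?L b)"
      by (rule homology_move.swap[OF le(1) L[OF sub(1)] le(2) L[OF sub(2)]])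
    then have s1: "homologous G arev u (?L es)
        ((based_loop \<tau> e @ based_loop \<tau> (arev e)) @ ?L (a @ b))"
      unfolding homologous_def Cons ab by (simp add: r_into_equivclp)
    have "based_loop \<tau> (arev e) = map arev (rev (based_loop \<tau> e))"
      using e by (simp add: based_loop_def rev_map comp_def)
    then have "homologous G arev u (based_loop \<tau> e @ based_loop \<tau> (arev e)) []"
      using homologous_rev_cancel[OF le(1)] by simp
    from homologous_append[OF this awalk_appendI[OF le] L[OF sub(3)]]
    have s2: "homologous G arev u ((based_loop \<tau> e @ based_loop \<tau> (arev e)) @ ?L (a @ b)) (?L (a @ b))"
      by simp
    have "path_chain arev (a @ b) = 0" using 1 Cons ab by simp
    then have s3: "homologous G arev u (?L (a @ b)) []"
      using 1(1)[rule_format, of "a @ b"] sub(3) by (simp add: Cons ab)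
    show ?thesis using homologous_trans[OF s1 homologous_trans[OF s2 s3]] .
  qed
qed

lemma connected_awalk:
  assumes "Digraph_Component.connected G" and "u \<in> verts G" and "v \<in> verts G"
  shows "\<exists>p. awalk u p v"
proof -
  have "strongly_connected G"
    using symmetric_connected_imp_strongly_connected[OF sym_arcs assms(1)] .
  then show ?thesis using assms(2,3) by (auto simp: reachable_awalk)
qed

text \<open>
  The chain is a complete homology invariant of paths with the same start: two paths with the same
  chain also have the same end, and then the loop \<open>p q\<^sup>-\<^sup>1\<close> has vanishing chain.
\<close>

lemma homologous_iff_path_chain_eq:
  assumes "Digraph_Component.connected G" and p: "awalk u p v" and q: "awalk u q w"
  shows "homologous G arev u p q \<longleftrightarrow> path_chain arev p = path_chain arev q"
proof
  show "path_chain arev p = path_chain arev q" if "homologous G arev u p q"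
    using that by (rule homologous_path_chain)
  assume eq: "path_chain arev p = path_chain arev q"
  have "w = v" using path_chain_eq_imp_same_end[OF p q eq] by simp
  note q = q[unfolded this]
  have u: "u \<in> verts G" using p by auto
  \<comment> \<open>With \<open>\<tau> u\<close> trivial, a loop at \<open>u\<close> is homologous to the product of its based loops.\<close>
  define \<tau> where "\<tau> x = (if x = u then [] else SOME p. awalk u p x)" for x
  have \<tau>: "awalk u (\<tau> x) x" if "x \<in> verts G" for x
    using someI_ex[OF connected_awalk[OF assms(1) u that]] u by (auto simp: \<tau>_def awalk_Nil_iff)
  have loop: "awalk u (p @ map arev (rev q)) u"
    using awalk_appendI[OF p awalk_rev[OF q]] .
  have "homologous G arev u (\<tau> u @ p @ map arev (rev q))
      (concat (map (based_loop \<tau>) (p @ map arev (rev q))) @ \<tau> u)"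
    using \<tau> u loop by (rule homologous_based_loops)
  moreover have "homologous G arev u (concat (map (based_loop \<tau>) (p @ map arev (rev q)))) []"
    using \<tau> u
  proof (rule based_loops_trivial)
    show "set (p @ map arev (rev q)) \<subseteq> arcs G" using loop by (rule awalkE)
    show "path_chain arev (p @ map arev (rev q)) = 0" by (simp only: path_chain_simps path_chain_rev) (simp add: eq)
  qed
  ultimately have "homologous G arev u (p @ map arev (rev q)) []"
    using homologous_trans[of G arev u "p @ map arev (rev q)"] by (simp add: \<tau>_def)
  from homologous_append[OF this loop q]
  have 1: "homologous G arev u (p @ map arev (rev q) @ q) q" by simp
  have 2: "homologous G arev u (p @ map arev (rev q) @ q) p"
    using homologous_prepend[OF homologous_rev_cancel'[OF q] p] by simp
  show "homologous G arev u p q"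
    using homologous_trans[OF homologous_sym[OF 2] 1] .
qed

section \<open>Cuts of a bridgeless graph\<close>

text \<open>
  If \<open>g\<close> were the only edge entering \<open>S\<close>, then deleting \<open>g\<close> and \<open>g\<^sup>-\<^sup>1\<close> would leave no edge between
  \<open>S\<close> and its complement.
\<close>

lemma nonbridge_second_crossing:
  assumes "\<not> is_bridge G arev g" and "g \<in> arcs G" and "tail G g \<notin> S" and "head G g \<in> S"
  obtains h where "h \<in> arcs G" "h \<noteq> g" "tail G h \<notin> S" "head G h \<in> S"
proof -
  let ?H = "pre_digraph.del_arc (del_arc g) (arev g)"
  have arcs_H: "arcs ?H = arcs G - {g} - {arev g}" and verts_H: "verts ?H = verts G"
    and ends_H: "tail ?H = tail G" "head ?H = head G"
    by (simp_all add: pre_digraph.del_arc_simps)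
  have "(tail G g, head G g) \<in> rtrancl_on (verts ?H) (symcl (arcs_ends ?H))"
    using assms(1,2) by (auto simp: is_bridge_def connected_conv verts_H)
  moreover have "x \<notin> S" if "(tail G g, x) \<in> rtrancl_on (verts ?H) (symcl (arcs_ends ?H))"
    and none: "\<nexists>h. h \<in> arcs G \<and> h \<noteq> g \<and> tail G h \<notin> S \<and> head G h \<in> S" for x
    using that(1)
  proof (induction rule: rtrancl_on_induct)
    case (step y z)
    then obtain h where h: "h \<in> arcs ?H"
      and ends: "(tail G h = y \<and> head G h = z) \<or> (tail G h = z \<and> head G h = y)"
      by (auto simp: symcl_def arcs_ends_conv ends_H)
    have "h \<in> arcs G" "h \<noteq> g" "arev h \<in> arcs G" "arev h \<noteq> g"
      using h by (auto simp: arcs_H)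
    with ends none step(5) show ?case by (metis head_arev tail_arev)
  qed (use assms(3) in simp)
  ultimately show ?thesis using assms(4) that by blast
qed

text \<open>
  The potential of a vertex is the inner product of \<open>c\<close> with the chain of a path to that vertex. It
  does not depend on the path, because two paths with the same ends differ by a cycle.
\<close>

lemma orthogonal_chain_potential:
  assumes "Digraph_Component.connected G" and c: "c \<in> chains G arev"
    and orth: "\<And>w. w \<in> cycles G arev \<Longrightarrow> chain_inner c w = 0"
  obtains \<phi> where "\<And>e. e \<in> arcs G \<Longrightarrow> Poly_Mapping.lookup c e = \<phi> (head G e) - \<phi> (tail G e)"
proof -
  obtain u where u: "u \<in> verts G" using assms(1) by (auto simp: connected_conv)
  define \<tau> where "\<tau> x = (SOME p. awalk u p x)" for x
  have \<tau>: "awalk u (\<tau> x) x" if "x \<in> verts G" for x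
    unfolding \<tau>_def using connected_awalk[OF assms(1) u that] by (rule someI_ex)
  define \<phi> where "\<phi> x = chain_inner c (path_chain arev (\<tau> x))" for x
  have "Poly_Mapping.lookup c e = \<phi> (head G e) - \<phi> (tail G e)" if e: "e \<in> arcs G" for e
  proof -
    have "awalk u (\<tau> (tail G e) @ [e]) (head G e)"
      using awalk_appendI[OF \<tau> arc_implies_awalk[OF e]] e by auto
    from path_chain_diff_in_cycles[OF this \<tau>]
    have "chain_inner c (path_chain arev (\<tau> (tail G e) @ [e]) - path_chain arev (\<tau> (head G e))) = 0"
      using orth e by auto
    then show ?thesis
      by (simp add: \<phi>_def chain_inner_right chain_inner_edge_chain_right[OF c e])
  qed
  then show ?thesis using that by blast
qed

text \<open>
  The edges entering \<open>S\<close> are counted positively and, by antisymmetry of chains, the edges leaving \<open>S\<close>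
  negatively, so the total is the net number of times that the path enters \<open>S\<close>.
\<close>

lemma flow_across_cut:
  assumes "awalk u p v" and "finite {g \<in> arcs G. tail G g \<notin> S \<and> head G g \<in> S}"
  shows "(\<Sum>g | g \<in> arcs G \<and> tail G g \<notin> S \<and> head G g \<in> S.
      Poly_Mapping.lookup (path_chain arev p) g) = of_bool (v \<in> S) - of_bool (u \<in> S)"
  using assms(1)
proof (induction p arbitrary: u)
  case Nil
  then show ?case by (auto simp: awalk_Nil_iff)
next
  case (Cons e p)
  then have e: "e \<in> arcs G" "u = tail G e" "awalk (head G e) p v" by (auto simp: awalk_Cons_iff)
  have "(\<Sum>g | g \<in> arcs G \<and> tail G g \<notin> S \<and> head G g \<in> S.
      Poly_Mapping.lookup (edge_chain arev e) g) = of_bool (head G e \<in> S) - of_bool (tail G e \<in> S)"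
    using e assms(2) by (simp add: lookup_edge_chain sum_subtractf)
  then show ?case using Cons.IH[OF e(3)] by (simp add: lookup_add sum.distrib e(2))
qed

text \<open>
  The arithmetic behind the claim that one edge \<open>g\<close> of the cut carries the whole flow. Here
  \<open>m + t a - s b\<close> is the coefficient of \<open>g\<close> in \<open>(c\<^sub>p + t e) - (c\<^sub>q + s f)\<close>, where \<open>m\<close> comes from the
  paths, and \<open>a\<close> and \<open>b\<close> are the coefficients of \<open>g\<close> in \<open>e\<close> and \<open>f\<close>; while \<open>P - Q\<close> is the total flow.
  If \<open>a\<close> or \<open>b\<close> is nonzero, then \<open>P\<close> or \<open>Q\<close> is congruent modulo \<open>1\<close> to the corresponding term
  \<open>t a\<close> or \<open>s b\<close>, and positivity of the coefficient bounds the integer \<open>m\<close> from below.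
\<close>

lemma integral_slope_bound:
  fixes a b t s P Q :: real and m :: int
  assumes e: "a = 1 \<and> P = t \<or> a = -1 \<and> P = 1 - t \<or> a = 0 \<and> 0 \<le> P \<and> P \<le> 1"
    and f: "b = 1 \<and> Q = s \<or> b = -1 \<and> Q = 1 - s \<or> b = 0 \<and> 0 \<le> Q \<and> Q \<le> 1"
    and ts: "t \<in> {0..1}" "s \<in> {0..1}"
    and pos: "0 < of_int m + t * a - s * b"
  shows "P - Q \<le> of_int m + t * a - s * b"
proof -
  have m: "real_of_int j \<le> of_int m \<or> real_of_int m \<le> of_int j - 1" for j
    using of_int_le_iff[of j m, where 'a = real] of_int_le_iff[of m "j - 1", where 'a = real]
    by (simp only: of_int_diff of_int_1) linarith
  have e': "t * a = t \<and> P = t \<or> t * a = - t \<and> P = 1 - t \<or> t * a = 0 \<and> 0 \<le> P \<and> P \<le> 1"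
    using e by (elim disjE conjE) simp_all
  have f': "s * b = s \<and> Q = s \<or> s * b = - s \<and> Q = 1 - s \<or> s * b = 0 \<and> 0 \<le> Q \<and> Q \<le> 1"
    using f by (elim disjE conjE) simp_all
  have "0 \<le> t" "t \<le> 1" "0 \<le> s" "s \<le> 1" using ts by auto
  with e' f' m[of "-1", unfolded of_int_minus of_int_1] m[of 0, unfolded of_int_0]
    m[of 1, unfolded of_int_1] pos
  show ?thesis by (elim disjE conjE; linarith)
qed

text \<open>
  A nonzero chain of this form would be positive on two edges of the cut above a potential level,
  although one of them already carries the whole flow.
\<close>

lemma bridgeless_orthogonal_imp_zero:
  assumes conn: "Digraph_Component.connected G" and "bridgeless G arev"
    and e: "e \<in> arcs G" "awalk u p (tail G e)" "t \<in> {0..1}"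
    and f: "f \<in> arcs G" "awalk u q (tail G f)" "s \<in> {0..1}"
    and c: "c = (path_chain arev p + t *\<^sub>R edge_chain arev e) -
      (path_chain arev q + s *\<^sub>R edge_chain arev f)"
    and orth: "\<And>w. w \<in> cycles G arev \<Longrightarrow> chain_inner c w = 0"
  shows "c = 0"
proof (rule ccontr)
  assume "c \<noteq> 0"
  have c_chain: "c \<in> chains G arev"
  proof -
    have "set p \<subseteq> arcs G" "set q \<subseteq> arcs G" using e(2) f(2) by (auto simp: awalk_def)
    then show ?thesis
      unfolding c using e(1) f(1)
      by (simp add: subspace_diff subspace_add subspace_scale subspace_chains path_chain_in_chains
          edge_chain_in_chains)
  qed
  obtain \<phi> where \<phi>: "\<And>g. g \<in> arcs G \<Longrightarrow> Poly_Mapping.lookup c g = \<phi> (head G g) - \<phi> (tail G g)"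
    using orthogonal_chain_potential[OF conn c_chain orth] by blast
  obtain g where g: "g \<in> arcs G" "Poly_Mapping.lookup c g > 0"
  proof -
    have "Poly_Mapping.keys c \<noteq> {}" using \<open>c \<noteq> 0\<close> by simp
    then obtain h where h: "h \<in> Poly_Mapping.keys c" by blast
    then have "h \<in> arcs G" "Poly_Mapping.lookup c (arev h) = - Poly_Mapping.lookup c h"
      "Poly_Mapping.lookup c h \<noteq> 0"
      using c_chain by (auto simp: chains_def in_keys_iff)
    then show ?thesis using that[of h] that[of "arev h"] by (cases "Poly_Mapping.lookup c h > 0") simp_all
  qed
  define S where "S = {v. \<phi> v > \<phi> (tail G g)}"
  define D where "D = {h \<in> arcs G. tail G h \<notin> S \<and> head G h \<in> S}"
  have D_pos: "Poly_Mapping.lookup c h > 0" if "h \<in> D" for h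
    using that \<phi>[of h] by (simp add: D_def S_def)
  have "D \<subseteq> Poly_Mapping.keys c" using D_pos by (metis in_keys_iff less_irrefl subsetI)
  then have fin: "finite D" by (rule finite_subset) simp
  have gD: "g \<in> D" using g \<phi>[OF g(1)] by (simp add: D_def S_def)
  have "\<not> is_bridge G arev g" using assms(2) by (simp add: bridgeless_def)
  moreover have "tail G g \<notin> S" "head G g \<in> S" using gD by (simp_all add: D_def)
  ultimately obtain h where "h \<in> arcs G" and h: "h \<noteq> g" and "tail G h \<notin> S" "head G h \<in> S"
    using nonbridge_second_crossing g(1) by metis
  then have hD: "h \<in> D" by (simp add: D_def)
  note flow = flow_across_cut[of _ _ _ S, folded D_def, OF _ fin]
  have edge_flow: "(\<Sum>g\<in>D. Poly_Mapping.lookup (edge_chain arev e) g) =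
      of_bool (head G e \<in> S) - of_bool (tail G e \<in> S)" if "e \<in> arcs G" for e
    using flow[OF arc_implies_awalk[OF that]] by simp
  \<comment> \<open>The indicator function of \<open>S\<close>, extended affinely along \<open>e\<close> and evaluated at parameter \<open>t\<close>.
    The flow into \<open>S\<close> is the difference of its values at the two points.\<close>
  define position where
    "position e t = of_bool (tail G e \<in> S) + t * (of_bool (head G e \<in> S) - of_bool (tail G e \<in> S))"
    for e and t :: real
  have position: "Poly_Mapping.lookup (edge_chain arev e) g = 1 \<and> position e t = t \<or>
      Poly_Mapping.lookup (edge_chain arev e) g = -1 \<and> position e t = 1 - t \<or>
      Poly_Mapping.lookup (edge_chain arev e) g = 0 \<and> 0 \<le> position e t \<and> position e t \<le> 1"
    if "e \<in> arcs G" "t \<in> {0..1}" for e t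
  proof -
    have S: "tail G g \<notin> S" "head G g \<in> S" using gD by (simp_all add: D_def)
    consider "g = e" | "g = arev e" | "g \<noteq> e" "g \<noteq> arev e" by blast
    then show ?thesis
    proof cases
      case 1
      then show ?thesis
        using S arev_neq[OF that(1)] by (simp add: position_def lookup_edge_chain)
    next
      case 2
      then show ?thesis
        using S that(1) arev_neq[OF that(1)] by (simp add: position_def lookup_edge_chain)
    next
      case 3
      then show ?thesis
        using that(2) by (simp add: position_def lookup_edge_chain)
    qed
  qed
  have "Poly_Mapping.lookup c g + Poly_Mapping.lookup c h = (\<Sum>x\<in>{g, h}. Poly_Mapping.lookup c x)"
    using h by simp
  also have "\<dots> \<le> (\<Sum>x\<in>D. Poly_Mapping.lookup c x)"
    using gD hD fin D_pos by (intro sum_mono2) (auto intro: less_imp_le)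
  also have "\<dots> = position e t - position f s"
    unfolding c lookup_minus lookup_add lookup_scaleR sum_subtractf sum.distrib position_def
      flow[OF e(2)] flow[OF f(2)] sum_distrib_left[symmetric] edge_flow[OF e(1)] edge_flow[OF f(1)]
    by simp
  also have "\<dots> \<le> Poly_Mapping.lookup c g"
  proof -
    obtain m :: int where m: "Poly_Mapping.lookup c g = of_int m +
        t * Poly_Mapping.lookup (edge_chain arev e) g - s * Poly_Mapping.lookup (edge_chain arev f) g"
    proof
      show "Poly_Mapping.lookup c g = of_int (int (count_list p g) - int (count_list p (arev g)) -
          (int (count_list q g) - int (count_list q (arev g)))) +
        t * Poly_Mapping.lookup (edge_chain arev e) g - s * Poly_Mapping.lookup (edge_chain arev f) g"
        by (simp add: c lookup_minus lookup_add lookup_scaleR lookup_path_chain)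
    qed
    show ?thesis
      using integral_slope_bound[OF position[OF e(1,3)] position[OF f(1,3)] e(3) f(3)] g(2)
      unfolding m by blast
  qed
  finally show False using D_pos[OF hD] by simp
qed

section \<open>The realization of the maximal abelian cover\<close>

lemma max_abelian_cover_simps [simp]:
  "verts (max_abelian_cover G arev x0) = atoms G arev x0"
  "arcs (max_abelian_cover G arev x0) = cover_arcs G arev x0"
  "tail (max_abelian_cover G arev x0) = fst"
  "head (max_abelian_cover G arev x0) = cover_head G arev x0"
  by (simp_all add: max_abelian_cover_def)

abbreviation cover_point where
  "cover_point x0 \<equiv> glued (max_abelian_cover G arev x0) (cover_rev G arev x0)"

lemma cover_arcsE:
  assumes "b \<in> cover_arcs G arev x0"
  obtains p e where "b = (homology_class G arev x0 p, e)" "e \<in> arcs G" "awalk x0 p (tail G e)"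
  using assms unfolding cover_arcs_def by auto

lemma cover_arcsI:
  "e \<in> arcs G \<Longrightarrow> awalk x0 p (tail G e) \<Longrightarrow> (homology_class G arev x0 p, e) \<in> cover_arcs G arev x0"
  unfolding cover_arcs_def by auto

lemma cover_rev_homology_class:
  assumes "e \<in> arcs G" and "awalk x0 p (tail G e)"
  shows "cover_rev G arev x0 (homology_class G arev x0 p, e) =
    (homology_class G arev x0 (p @ [e]), arev e)"
  using cover_head_homology_class[OF assms(2,1)] cover_arcsI[OF assms] by (simp add: cover_rev_def)

lemma cover_point_eqI:
  assumes "gluing (max_abelian_cover G arev x0) (cover_rev G arev x0) z z'"
  shows "cover_point x0 z = cover_point x0 z'"
proof -
  have "equivclp (gluing (max_abelian_cover G arev x0) (cover_rev G arev x0)) z z'"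
    using assms by (rule r_into_equivclp)
  then show ?thesis
    unfolding glued_def using equivclp_sym equivclp_trans by fast
qed

lemma cover_point_arc:
  assumes "e \<in> arcs G" and "awalk x0 p (tail G e)"
  shows "cover_point x0 (Inr ((homology_class G arev x0 p, e), 0)) =
      cover_point x0 (Inl (homology_class G arev x0 p))"
    and "cover_point x0 (Inr ((homology_class G arev x0 p, e), 1)) =
      cover_point x0 (Inl (homology_class G arev x0 (p @ [e])))"
    and "t \<in> {0..1} \<Longrightarrow> cover_point x0 (Inr ((homology_class G arev x0 p, e), t)) =
      cover_point x0 (Inr ((homology_class G arev x0 (p @ [e]), arev e), 1 - t))"
proof -
  let ?b = "(homology_class G arev x0 p, e)"
  have b: "?b \<in> arcs (max_abelian_cover G arev x0)" using cover_arcsI[OF assms] by simp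
  show "cover_point x0 (Inr (?b, 0)) = cover_point x0 (Inl (homology_class G arev x0 p))"
    using cover_point_eqI[OF gluing.intros(1)[OF b]] by simp
  show "cover_point x0 (Inr (?b, 1)) = cover_point x0 (Inl (homology_class G arev x0 (p @ [e])))"
    using cover_point_eqI[OF gluing.intros(2)[OF b]] cover_head_homology_class[OF assms(2,1)] by simp
  show "cover_point x0 (Inr (?b, t)) =
      cover_point x0 (Inr ((homology_class G arev x0 (p @ [e]), arev e), 1 - t))" if "t \<in> {0..1}"
    using cover_point_eqI[OF gluing.intros(3)[OF b that]] cover_rev_homology_class[OF assms] by simp
qed

text \<open>
  The values that an affine extension is forced to take.
\<close>

fun cell_value :: "'b list set + ('b list set \<times> 'b) \<times> real \<Rightarrow> 'b \<Rightarrow>\<^sub>0 real" where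
  "cell_value (Inl a) = atom_map G arev a"
| "cell_value (Inr ((a, e), t)) = atom_map G arev a + t *\<^sub>R cycle_proj G arev (edge_chain arev e)"

lemma cell_value_gluing:
  assumes fin: "finite_dimensional (cycles G arev)"
    and "gluing (max_abelian_cover G arev x0) (cover_rev G arev x0) z z'"
  shows "cell_value z = cell_value z'"
  using assms(2)
proof cases
  case (1 b)
  then show ?thesis by (cases b) simp
next
  case (2 b)
  then obtain p e where "b = (homology_class G arev x0 p, e)" "e \<in> arcs G" "awalk x0 p (tail G e)"
    by (auto elim: cover_arcsE)
  with 2 show ?thesis
    by (simp add: cover_head_homology_class atom_map_homology_class linear_add[OF linear_cycle_proj[OF fin]])
next
  case (3 b t)
  then obtain p e where "b = (homology_class G arev x0 p, e)" "e \<in> arcs G" "awalk x0 p (tail G e)"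
    by (auto elim: cover_arcsE)
  with 3 show ?thesis
    by (simp add: cover_rev_homology_class atom_map_homology_class linear_add[OF linear_cycle_proj[OF fin]]
        linear_neg[OF linear_cycle_proj[OF fin]] scaleR_left_diff_distrib)
qed

lemma cell_value_cong:
  assumes "finite_dimensional (cycles G arev)" and "cover_point x0 z = cover_point x0 z'"
  shows "cell_value z = cell_value z'"
proof -
  have "z' \<in> cover_point x0 z'" by (simp add: glued_def)
  then have "equivclp (gluing (max_abelian_cover G arev x0) (cover_rev G arev x0)) z z'"
    using assms(2) unfolding glued_def by blast
  then show ?thesis by (rule equivclp_invariant) (rule cell_value_gluing[OF assms(1)])
qed

lemma atom_map_in_cycles:
  "finite_dimensional (cycles G arev) \<Longrightarrow> atom_map G arev a \<in> cycles G arev"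
  unfolding atom_map_def by (rule cycle_proj_in_cycles)

lemma cell_value_in_cycles:
  assumes "finite_dimensional (cycles G arev)"
  shows "cell_value z \<in> cycles G arev"
  using subspace_cycles[OF assms] cycle_proj_in_cycles[OF assms] atom_map_in_cycles[OF assms]
  by (cases z rule: cell_value.cases) (auto simp: subspace_add subspace_scale)

text \<open>
  On the bond \<open>(\<lbrakk>p\<rbrakk>, e)\<close>, an affine extension takes the form \<open>A + t B\<close>; the values at the ends give
  \<open>A = i(\<lbrakk>p\<rbrakk>)\<close> and \<open>A + B = i(\<lbrakk>p e\<rbrakk>)\<close>, whence \<open>B = \<pi>(e)\<close>.
\<close>

lemma affine_extension_iff:
  assumes fin: "finite_dimensional (cycles G arev)"
  shows "affine_extension G arev x0 j \<longleftrightarrow> j \<in> extensional (topspace (cover_space G arev x0)) \<and>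
    (\<forall>z\<in>realization_cells (max_abelian_cover G arev x0). j (cover_point x0 z) = cell_value z)"
    (is "_ \<longleftrightarrow> _ \<and> ?cells")
proof -
  let ?C = "max_abelian_cover G arev x0" and ?P = "cover_point x0"
  have top: "topspace (cover_space G arev x0) = ?P ` realization_cells ?C"
    by (simp add: cover_space_def topspace_realization_topology realization_def)
  have bond: "Inr (b, t) \<in> realization_cells ?C" if "b \<in> cover_arcs G arev x0" "t \<in> {0..1}" for b t
    using that by (simp add: realization_cells_def)
  have cells: ?cells
    if vertex: "\<And>a. a \<in> atoms G arev x0 \<Longrightarrow> j (?P (Inl a)) = atom_map G arev a"
      and affine: "affine_on_bonds ?C (cover_rev G arev x0) (cycles G arev) j"
  proof
    fix z assume "z \<in> realization_cells ?C"
    then consider a where "z = Inl a" "a \<in> atoms G arev x0"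
      | b t where "z = Inr (b, t)" "b \<in> cover_arcs G arev x0" "t \<in> {0..1}"
      by (auto simp: realization_cells_def)
    then show "j (?P z) = cell_value z"
    proof cases
      case 1
      then show ?thesis using vertex by simp
    next
      case (2 b t)
      obtain A B where AB: "\<And>t. t \<in> {0..1} \<Longrightarrow> j (?P (Inr (b, t))) = A + t *\<^sub>R B"
        using affine 2(2) unfolding affine_on_bonds_def bond_param_def by fastforce
      obtain p e where b: "b = (homology_class G arev x0 p, e)"
        and e: "e \<in> arcs G" "awalk x0 p (tail G e)" using 2(2) by (rule cover_arcsE)
      have pe: "awalk x0 (p @ [e]) (head G e)"
        using awalk_appendI[OF e(2) arc_implies_awalk[OF e(1)]] .
      have "homology_class G arev x0 p \<in> atoms G arev x0"
        and "homology_class G arev x0 (p @ [e]) \<in> atoms G arev x0"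
        unfolding atoms_def using e(2) pe by blast+
      note vertices = this[THEN vertex]
      have "A = atom_map G arev (homology_class G arev x0 p)"
        using AB[of 0] cover_point_arc(1)[OF e] vertices(1) by (simp add: b)
      moreover have "A + B = atom_map G arev (homology_class G arev x0 (p @ [e]))"
        using AB[of 1] cover_point_arc(2)[OF e] vertices(2) by (simp add: b)
      ultimately have "B = cycle_proj G arev (edge_chain arev e)"
        by (simp add: atom_map_homology_class linear_add[OF linear_cycle_proj[OF fin]])
      then show ?thesis using AB[OF 2(3)] \<open>A = _\<close> by (simp add: 2 b)
    qed
  qed
  show ?thesis
  proof
    assume "affine_extension G arev x0 j"
    then show "j \<in> extensional (topspace (cover_space G arev x0)) \<and> ?cells"
      using cells by (auto simp: affine_extension_def vertex_point_def PiE_def)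
  next
    assume j: "j \<in> extensional (topspace (cover_space G arev x0)) \<and> ?cells"
    have "j \<in> topspace (cover_space G arev x0) \<rightarrow> cycles G arev"
      using j cell_value_in_cycles[OF fin] by (auto simp: top)
    moreover have "j (?P (Inl a)) = atom_map G arev a" if "a \<in> atoms G arev x0" for a
      using j that by (simp add: realization_cells_def)
    moreover have "affine_on_bonds ?C (cover_rev G arev x0) (cycles G arev) j"
      unfolding affine_on_bonds_def
    proof
      fix b assume "b \<in> arcs ?C"
      then have "\<forall>t\<in>{0..1}. j (bond_param ?C (cover_rev G arev x0) b t) =
          atom_map G arev (fst b) + t *\<^sub>R cycle_proj G arev (edge_chain arev (snd b))"
        using j bond by (cases b) (simp add: bond_param_def)
      then show "\<exists>A\<in>cycles G arev. \<exists>B\<in>cycles G arev. \<forall>t\<in>{0..1}.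
          j (bond_param ?C (cover_rev G arev x0) b t) = A + t *\<^sub>R B"
        using atom_map_in_cycles[OF fin] cycle_proj_in_cycles[OF fin] by blast
    qed
    ultimately show "affine_extension G arev x0 j"
      using j by (simp add: affine_extension_def vertex_point_def PiE_def)
  qed
qed

lemma affine_extension_ex1:
  assumes fin: "finite_dimensional (cycles G arev)"
  shows "\<exists>!j. affine_extension G arev x0 j"
proof (rule ex_ex1I)
  let ?cells = "realization_cells (max_abelian_cover G arev x0)"
  have top: "topspace (cover_space G arev x0) = cover_point x0 ` ?cells"
    by (simp add: cover_space_def topspace_realization_topology realization_def)
  define j where "j = restrict (\<lambda>x. cell_value (SOME z. cover_point x0 z = x))
    (topspace (cover_space G arev x0))"
  have "j (cover_point x0 z) = cell_value z" if "z \<in> ?cells" for z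
  proof -
    have "cover_point x0 (SOME z'. cover_point x0 z' = cover_point x0 z) = cover_point x0 z"
      by (rule someI) simp
    from cell_value_cong[OF fin this] show ?thesis using that by (simp add: j_def top)
  qed
  then have "affine_extension G arev x0 j"
    unfolding affine_extension_iff[OF fin] by (simp add: j_def)
  then show "\<exists>j. affine_extension G arev x0 j" by blast
  fix j j' assume "affine_extension G arev x0 j" "affine_extension G arev x0 j'"
  then have j: "j \<in> extensional (cover_point x0 ` ?cells)" "j' \<in> extensional (cover_point x0 ` ?cells)"
    and eq: "\<And>z. z \<in> ?cells \<Longrightarrow> j (cover_point x0 z) = j' (cover_point x0 z)"
    unfolding affine_extension_iff[OF fin] top by simp_all
  from j show "j = j'" by (rule extensionalityI) (use eq in blast)
qed

text \<open>
  In the quotient topology, continuity can be tested on the parametrization of each bond, where the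
  map is affine in \<open>t\<close>.
\<close>

lemma affine_extension_continuous:
  assumes fin: "finite_dimensional (cycles G arev)" and "affine_extension G arev x0 j"
  shows "continuous_map (cover_space G arev x0) (top_of_set (cycles G arev)) j"
  unfolding continuous_map_def
proof (intro conjI allI impI)
  show "j \<in> topspace (cover_space G arev x0) \<rightarrow> topspace (top_of_set (cycles G arev))"
    using assms(2) by (auto simp: affine_extension_def)
  fix U assume "openin (top_of_set (cycles G arev)) U"
  then obtain T where T: "open T" "U = cycles G arev \<inter> T" by (auto simp: openin_open)
  let ?C = "max_abelian_cover G arev x0" and ?r = "cover_rev G arev x0"
  let ?V = "{x \<in> topspace (cover_space G arev x0). j x \<in> U}"
  have top: "topspace (cover_space G arev x0) = realization ?C ?r"
    by (simp add: cover_space_def topspace_realization_topology)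
  have "openin (realization_topology ?C ?r) ?V"
    unfolding openin_realization_topology
  proof (intro conjI ballI)
    fix b assume b: "b \<in> arcs ?C"
    let ?f = "\<lambda>t. atom_map G arev (fst b) + t *\<^sub>R cycle_proj G arev (edge_chain arev (snd b))"
    have cell: "Inr (b, t) \<in> realization_cells ?C" if "t \<in> {0..1}" for t
      using that b by (simp add: realization_cells_def)
    have f: "j (bond_param ?C ?r b t) = ?f t" if "t \<in> {0..1}" for t
      using assms(2) cell[OF that] unfolding affine_extension_iff[OF fin] bond_param_def
      by (cases b) simp
    have cyc: "?f t \<in> cycles G arev" for t
      using subspace_cycles[OF fin] atom_map_in_cycles[OF fin] cycle_proj_in_cycles[OF fin]
      by (simp add: subspace_add subspace_scale)
    have mem: "bond_param ?C ?r b t \<in> realization ?C ?r" if "t \<in> {0..1}" for t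
      using cell[OF that] by (simp add: bond_param_def realization_def)
    have "{t \<in> {0..1}. bond_param ?C ?r b t \<in> ?V} = {0..1} \<inter> ?f -` T"
      using f mem cyc by (auto simp: top T(2))
    moreover have "openin (top_of_set {0..1}) ({0..1} \<inter> ?f -` T)"
      by (intro continuous_openin_preimage_gen T continuous_intros)
    ultimately show "openin (top_of_set {0..1}) {t \<in> {0..1}. bond_param ?C ?r b t \<in> ?V}" by simp
  qed (use top in auto)
  then show "openin (cover_space G arev x0) ?V" by (simp only: cover_space_def)
qed

section \<open>Injectivity\<close>

lemma cover_point_endpoint:
  assumes "e \<in> arcs G" and "awalk x0 p (tail G e)" and "t = 0 \<or> t = 1"
  obtains q x where "awalk x0 q x" "path_chain arev q = path_chain arev p + t *\<^sub>R edge_chain arev e"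
    "cover_point x0 (Inr ((homology_class G arev x0 p, e), t)) = cover_point x0 (Inl (homology_class G arev x0 q))"
  using assms(3)
proof
  assume "t = 0"
  then show ?thesis using that[OF assms(2)] cover_point_arc(1)[OF assms(1,2)] by simp
next
  assume "t = 1"
  then show ?thesis
    using that[OF awalk_appendI[OF assms(2) arc_implies_awalk[OF assms(1)]]]
      cover_point_arc(2)[OF assms(1,2)] by simp
qed

lemma homology_class_eq_if_chain_eq:
  assumes "Digraph_Component.connected G" and "awalk u p v" and "awalk u q w"
    and "path_chain arev p = path_chain arev q"
  shows "homology_class G arev u p = homology_class G arev u q"
  by (rule homology_class_eqI) (simp add: homologous_iff_path_chain_eq[OF assms(1-3)] assms(4))

lemma cover_point_eq_if_endpoints:
  assumes conn: "Digraph_Component.connected G"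
    and e: "e \<in> arcs G" "awalk x0 p (tail G e)" "t = 0 \<or> t = 1"
    and f: "f \<in> arcs G" "awalk x0 q (tail G f)" "s = 0 \<or> s = 1"
    and eq: "path_chain arev p + t *\<^sub>R edge_chain arev e = path_chain arev q + s *\<^sub>R edge_chain arev f"
  shows "cover_point x0 (Inr ((homology_class G arev x0 p, e), t)) =
    cover_point x0 (Inr ((homology_class G arev x0 q, f), s))"
proof -
  obtain p' x where p': "awalk x0 p' x" "path_chain arev p' = path_chain arev p + t *\<^sub>R edge_chain arev e"
    "cover_point x0 (Inr ((homology_class G arev x0 p, e), t)) = cover_point x0 (Inl (homology_class G arev x0 p'))"
    using cover_point_endpoint[OF e] .
  obtain q' y where q': "awalk x0 q' y" "path_chain arev q' = path_chain arev q + s *\<^sub>R edge_chain arev f"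
    "cover_point x0 (Inr ((homology_class G arev x0 q, f), s)) = cover_point x0 (Inl (homology_class G arev x0 q'))"
    using cover_point_endpoint[OF f] .
  have "homology_class G arev x0 p' = homology_class G arev x0 q'"
    using homology_class_eq_if_chain_eq[OF conn p'(1) q'(1)] p'(2) q'(2) eq by simp
  then show ?thesis using p'(3) q'(3) by simp
qed

lemma lookup_path_chain_Ints: "Poly_Mapping.lookup (path_chain arev p) e \<in> \<int>"
  by (simp add: lookup_path_chain)

lemma Ints_unit_interval:
  fixes t :: real
  assumes "t \<in> \<int>" and "t \<in> {0..1}"
  shows "t = 0 \<or> t = 1"
proof -
  obtain m where m: "t = of_int m" using assms(1) by (rule Ints_cases)
  then have "0 \<le> m" "m \<le> 1" using assms(2) by auto
  then have "m = 0 \<or> m = 1" by linarith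
  then show ?thesis using m by auto
qed

text \<open>
  Comparing coefficients at \<open>e\<close> shows that \<open>t - s\<close> is an integer. Thus either \<open>t = s\<close>, and \<open>p\<close> and
  \<open>q\<close> have the same chain, or \<open>{t, s} = {0, 1}\<close>, and both points are vertices.
\<close>

lemma cover_point_eq_same_arc:
  assumes conn: "Digraph_Component.connected G"
    and e: "e \<in> arcs G" "awalk x0 p (tail G e)" "t \<in> {0..1}"
    and f: "awalk x0 q (tail G e)" "s \<in> {0..1}"
    and eq: "path_chain arev p + t *\<^sub>R edge_chain arev e = path_chain arev q + s *\<^sub>R edge_chain arev e"
  shows "cover_point x0 (Inr ((homology_class G arev x0 p, e), t)) =
    cover_point x0 (Inr ((homology_class G arev x0 q, e), s))"
proof (cases "t = s")
  case True
  then show ?thesis using homology_class_eq_if_chain_eq[OF conn e(2) f(1)] eq by simp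
next
  case False
  have "Poly_Mapping.lookup (path_chain arev p) e + t = Poly_Mapping.lookup (path_chain arev q) e + s"
    using arg_cong[OF eq, of "\<lambda>c. Poly_Mapping.lookup c e"] arev_neq[OF e(1), symmetric]
    by (simp add: lookup_add lookup_scaleR lookup_edge_chain)
  then have "t - s = Poly_Mapping.lookup (path_chain arev q) e - Poly_Mapping.lookup (path_chain arev p) e"
    by simp
  then have "t - s \<in> \<int>" by (simp add: lookup_path_chain_Ints)
  then have "\<bar>t - s\<bar> \<in> \<int>" by simp
  moreover have "\<bar>t - s\<bar> \<in> {0..1}" using e(3) f(2) by auto
  ultimately have "\<bar>t - s\<bar> = 1" using Ints_unit_interval[of "\<bar>t - s\<bar>"] False by auto
  then have "t = 0 \<or> t = 1" "s = 0 \<or> s = 1" using e(3) f(2) by auto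
  then show ?thesis by (intro cover_point_eq_if_endpoints conn e f eq)
qed

text \<open>
  The case \<open>f = e\<^sup>-\<^sup>1\<close> reduces to \<open>f = e\<close> by parametrizing the second bond backwards. If \<open>e\<close> and \<open>f\<close>
  are different edges up to inversion, then \<open>t\<close> and \<open>s\<close> are integers, and both points are vertices.
\<close>

lemma cover_point_eq_if_chain_eq:
  assumes conn: "Digraph_Component.connected G"
    and e: "e \<in> arcs G" "awalk x0 p (tail G e)" "t \<in> {0..1}"
    and f: "f \<in> arcs G" "awalk x0 q (tail G f)" "s \<in> {0..1}"
    and eq: "path_chain arev p + t *\<^sub>R edge_chain arev e = path_chain arev q + s *\<^sub>R edge_chain arev f"
  shows "cover_point x0 (Inr ((homology_class G arev x0 p, e), t)) =
    cover_point x0 (Inr ((homology_class G arev x0 q, f), s))"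
proof -
  consider "f = e" | "f = arev e" | "f \<noteq> e" "f \<noteq> arev e" by blast
  then show ?thesis
  proof cases
    case 1
    then show ?thesis using cover_point_eq_same_arc[OF conn e] f eq by blast
  next
    case 2
    have q: "awalk x0 (q @ [f]) (tail G e)"
      using awalk_appendI[OF f(2) arc_implies_awalk[OF f(1)]] 2 e(1) by simp
    have "path_chain arev p + t *\<^sub>R edge_chain arev e =
        path_chain arev (q @ [f]) + (1 - s) *\<^sub>R edge_chain arev e"
      using eq by (simp add: 2 algebra_simps)
    then have "cover_point x0 (Inr ((homology_class G arev x0 p, e), t)) =
        cover_point x0 (Inr ((homology_class G arev x0 (q @ [f]), e), 1 - s))"
      using f(3) by (intro cover_point_eq_same_arc conn e q) auto
    then show ?thesis using cover_point_arc(3)[OF f] 2 by simp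
  next
    case 3
    then have ne: "e \<noteq> f" "e \<noteq> arev f" by auto
    have "Poly_Mapping.lookup (path_chain arev p) e + t = Poly_Mapping.lookup (path_chain arev q) e"
      using arg_cong[OF eq, of "\<lambda>c. Poly_Mapping.lookup c e"] arev_neq[OF e(1), symmetric] ne
      by (simp add: lookup_add lookup_scaleR lookup_edge_chain)
    then have "t = Poly_Mapping.lookup (path_chain arev q) e - Poly_Mapping.lookup (path_chain arev p) e"
      by simp
    then have "t = 0 \<or> t = 1"
      using e(3) by (intro Ints_unit_interval) (simp_all add: lookup_path_chain_Ints)
    have "Poly_Mapping.lookup (path_chain arev p) f = Poly_Mapping.lookup (path_chain arev q) f + s"
      using arg_cong[OF eq, of "\<lambda>c. Poly_Mapping.lookup c f"] arev_neq[OF f(1), symmetric] 3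
      by (simp add: lookup_add lookup_scaleR lookup_edge_chain)
    then have "s = Poly_Mapping.lookup (path_chain arev p) f - Poly_Mapping.lookup (path_chain arev q) f"
      by simp
    then have "s = 0 \<or> s = 1"
      using f(3) by (intro Ints_unit_interval) (simp_all add: lookup_path_chain_Ints)
    with \<open>t = 0 \<or> t = 1\<close> show ?thesis by (intro cover_point_eq_if_endpoints conn e f eq)
  qed
qed

lemma cell_value_inject:
  assumes fin: "finite_dimensional (cycles G arev)"
    and conn: "Digraph_Component.connected G" and "bridgeless G arev"
    and e: "e \<in> arcs G" "awalk x0 p (tail G e)" "t \<in> {0..1}"
    and f: "f \<in> arcs G" "awalk x0 q (tail G f)" "s \<in> {0..1}"
    and eq: "cell_value (Inr ((homology_class G arev x0 p, e), t)) =
      cell_value (Inr ((homology_class G arev x0 q, f), s))"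
  shows "cover_point x0 (Inr ((homology_class G arev x0 p, e), t)) =
    cover_point x0 (Inr ((homology_class G arev x0 q, f), s))"
proof -
  define c where "c = (path_chain arev p + t *\<^sub>R edge_chain arev e) -
      (path_chain arev q + s *\<^sub>R edge_chain arev f)"
  note lin = linear_cycle_proj[OF fin]
  have "cycle_proj G arev c = 0"
    using eq by (simp add: c_def atom_map_homology_class linear_add[OF lin] linear_diff[OF lin]
        linear_scale[OF lin])
  then have "chain_inner c w = 0" if "w \<in> cycles G arev" for w
    using cycle_proj_orthogonal[OF fin that, of c] by simp
  then have "c = 0"
    using bridgeless_orthogonal_imp_zero[OF conn assms(3) e f c_def] by blast
  then have "path_chain arev p + t *\<^sub>R edge_chain arev e = path_chain arev q + s *\<^sub>R edge_chain arev f"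
    unfolding c_def by (simp only: right_minus_eq)
  then show ?thesis by (rule cover_point_eq_if_chain_eq[OF conn e f])
qed

text \<open>
  This is what puts every vertex of the cover onto a bond, at parameter \<open>0\<close>; a graph without edges
  has to be treated separately.
\<close>

lemma ex_out_arc:
  assumes "Digraph_Component.connected G" and "g \<in> arcs G" and "x \<in> verts G"
  obtains e where "e \<in> arcs G" "tail G e = x"
proof -
  obtain r where r: "awalk x r (tail G g)"
    using connected_awalk[OF assms(1,3) tail_in_verts[OF assms(2)]] by (rule exE)
  show ?thesis
  proof (cases r)
    case Nil
    then show ?thesis using r assms(2) by (auto simp: awalk_Nil_iff intro: that)
  next
    case (Cons e r')
    then show ?thesis using r by (auto simp: awalk_Cons_iff intro: that)
  qed
qed

lemma affine_extension_inj:
  assumes fin: "finite_dimensional (cycles G arev)"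
    and conn: "Digraph_Component.connected G" and "bridgeless G arev"
    and j: "affine_extension G arev x0 j"
  shows "inj_on j (topspace (cover_space G arev x0))"
proof -
  let ?cells = "realization_cells (max_abelian_cover G arev x0)"
  have top: "topspace (cover_space G arev x0) = cover_point x0 ` ?cells"
    by (simp add: cover_space_def topspace_realization_topology realization_def)
  have j_cell: "j (cover_point x0 z) = cell_value z" if "z \<in> ?cells" for z
    using j that by (simp add: affine_extension_iff[OF fin])
  show ?thesis
  proof (cases "arcs G = {}")
    case True
    then have "p = []" if "awalk x0 p x" for p x using that by (auto simp: awalk_def)
    then have "atoms G arev x0 \<subseteq> {homology_class G arev x0 []}" by (auto simp: atoms_def)
    moreover have "cover_arcs G arev x0 = {}" using True by (simp add: cover_arcs_def)
    ultimately have "?cells \<subseteq> {Inl (homology_class G arev x0 [])}"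
      by (auto simp: realization_cells_def)
    then show ?thesis unfolding top by (auto intro!: inj_onI)
  next
    case False
    then obtain g where g: "g \<in> arcs G" by blast
    have bond: "\<exists>p e t. e \<in> arcs G \<and> awalk x0 p (tail G e) \<and> t \<in> {0..1} \<and>
        cover_point x0 z = cover_point x0 (Inr ((homology_class G arev x0 p, e), t))"
      if z: "z \<in> ?cells" for z
    proof (cases z)
      case (Inl a)
      then obtain p x where p: "a = homology_class G arev x0 p" "awalk x0 p x"
        using z by (auto simp: realization_cells_def atoms_def)
      obtain e where "e \<in> arcs G" "tail G e = x" using ex_out_arc[OF conn g, of x] p(2) by auto
      with p cover_point_arc(1)[of e x0 p] Inl show ?thesis
        by (intro exI[of _ p] exI[of _ e] exI[of _ 0]) simp
    next
      case (Inr bt)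
      then obtain b t where b: "z = Inr (b, t)" "b \<in> cover_arcs G arev x0" "t \<in> {0..1}"
        using z by (auto simp: realization_cells_def)
      from b(2) obtain p e where "b = (homology_class G arev x0 p, e)" "e \<in> arcs G"
        "awalk x0 p (tail G e)" by (rule cover_arcsE)
      then show ?thesis using b(1,3) by blast
    qed
    show ?thesis
    proof (rule inj_onI)
      fix P Q assume "P \<in> topspace (cover_space G arev x0)" "Q \<in> topspace (cover_space G arev x0)"
        and jPQ: "j P = j Q"
      then obtain z z' where z: "z \<in> ?cells" "P = cover_point x0 z"
        and z': "z' \<in> ?cells" "Q = cover_point x0 z'" unfolding top by blast
      from bond[OF z(1)] obtain p e t where e: "e \<in> arcs G" "awalk x0 p (tail G e)" "t \<in> {0..1}"
        and P: "P = cover_point x0 (Inr ((homology_class G arev x0 p, e), t))"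
        unfolding z(2) by blast
      from bond[OF z'(1)] obtain q f s where f: "f \<in> arcs G" "awalk x0 q (tail G f)" "s \<in> {0..1}"
        and Q: "Q = cover_point x0 (Inr ((homology_class G arev x0 q, f), s))"
        unfolding z'(2) by blast
      have "Inr ((homology_class G arev x0 p, e), t) \<in> ?cells" "Inr ((homology_class G arev x0 q, f), s) \<in> ?cells"
        using e f by (auto simp: realization_cells_def intro: cover_arcsI)
      from this[THEN j_cell] jPQ
      show "P = Q" unfolding P Q
        by (intro cell_value_inject[OF fin conn assms(3) e f]) simp
    qed
  qed
qed

end

theorem theorem8:
  fixes X :: "('v, 'e) pre_digraph" and arev :: "'e \<Rightarrow> 'e" and x0 :: 'v
  assumes "bidirected_digraph X arev"
    and "Digraph_Component.connected X"
    and "x0 \<in> verts X"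
    and "finite_dimensional (cycles X arev)"
  shows "(\<exists>!j. affine_extension X arev x0 j) \<and>
    (\<forall>j. affine_extension X arev x0 j \<longrightarrow>
       continuous_map (cover_space X arev x0) (top_of_set (cycles X arev)) j) \<and>
    (bridgeless X arev \<longrightarrow>
       (\<forall>j. affine_extension X arev x0 j \<longrightarrow> inj_on j (topspace (cover_space X arev x0))))"
proof -
  interpret bidirected_digraph X arev by fact
  show ?thesis
    using affine_extension_ex1[OF assms(4)] affine_extension_continuous[OF assms(4)]
      affine_extension_inj[OF assms(4,2)] by simp
qed

end
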